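(* Consider the preemptive variant, an instance $I$ and a makespan $T\ge T_{\min}$, and suppose $I$ is nice for $T$, i.e. $I_{\exp}^0=\emptyset$. Let $\alpha_i'=\lfloor P(C_i)/(T-s_i)\rfloor$ for $i\in I_{\exp}^+$, \[L_{\mathrm{nice}}=P(J)+\sum_{i\in I_{\exp}^+}\alpha_i' s_i+\sum_{i\in I_{\exp}^-\cup I_{\mathrm{chp}}} s_i,\qquad m_{\mathrm{nice}}=\lceil \tfrac12|I_{\exp}^-|\rceil+\sum_{i\in I_{\exp}^+}\alpha_i'.\] Then: (i) if $mT<L_{\mathrm{nice}}$ or $m<m_{\mathrm{nice}}$, then $T<\mathrm{OPT}_{\mathrm{pmtn}}(I)$; (ii) otherwise a feasible preemptive schedule with makespan at most $\tfrac32T$ can be computed in time $\mathcal{O}(n)$.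
   Context: An instance consists of $m$ identical machines, $n$ jobs $J$, a partition $J=C_1\,\dot\cup\dots\dot\cup\,C_c$ into nonempty classes, processing times $t_j\in\mathbb{N}$ and setup times $s_i\in\mathbb{N}$. On each machine one item at a time; a setup of class $i$ (length $s_i$) is required whenever a machine starts processing load of class $i$ or switches to class $i$ from a different class; setups are not preempted. Preemptive variant: jobs may be split into pieces on arbitrary machines, but pieces of the same job may not be processed at overlapping times; $\mathrm{OPT}_{\mathrm{pmtn}}(I)$ is the minimum makespan. Notation: $P(K)=\sum_{j\in K}t_j$; $N=\sum_i s_i+P(J)$; $t^{(i)}_{\max}=\max_{j\in C_i}t_j$; $T_{\min}=\max\{N/m,\max_i(s_i+t^{(i)}_{\max})\}$. For $T>0$: class $i$ is expensive ($i\in I_{\exp}$) if $s_i>T/2$ and cheap ($i\in I_{\mathrm{chp}}$) otherwise. $I_{\exp}^+=\{i\in I_{\exp}: T\le s_i+P(C_i)\}$, $I_{\exp}^0=\{i\in I_{\exp}:\tfrac34T<s_i+P(C_i)<T\}$, $I_{\exp}^-=\{i\in I_{\exp}: s_i+P(C_i)\le\tfrac34T\}$. *)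

theory Defs
  imports Complex_Main
begin

section \<open>Instances\<close>

text \<open>
  Jobs are the numbers below \<open>num_jobs I\<close>, classes the numbers below \<open>num_classes I\<close>; the partition
  of the jobs is given by the class of each job.  Processing times are positive, so that
  \<open>T - s\<^sub>i > 0\<close> whenever \<open>T \<ge> T\<^sub>m\<^sub>i\<^sub>n\<close>; setup times may be zero.
\<close>

record batch_instance =
  num_machines :: nat
  num_jobs :: nat
  num_classes :: nat
  class_of :: "nat \<Rightarrow> nat"
  proc_time :: "nat \<Rightarrow> nat"
  setup_time :: "nat \<Rightarrow> nat"

definition jobs_of_class :: "batch_instance \<Rightarrow> nat \<Rightarrow> nat set" where
  "jobs_of_class I i = {j. j < num_jobs I \<and> class_of I j = i}"

definition wf_instance :: "batch_instance \<Rightarrow> bool" where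
  "wf_instance I \<longleftrightarrow>
     0 < num_machines I \<and> 0 < num_jobs I \<and>
     (\<forall>j<num_jobs I. class_of I j < num_classes I \<and> 0 < proc_time I j) \<and>
     (\<forall>i<num_classes I. jobs_of_class I i \<noteq> {})"

definition load :: "batch_instance \<Rightarrow> nat set \<Rightarrow> nat" where
  "load I K = (\<Sum>j\<in>K. proc_time I j)"

definition total_load :: "batch_instance \<Rightarrow> nat" where
  "total_load I = (\<Sum>i<num_classes I. setup_time I i) + load I {..<num_jobs I}"

definition t_max :: "batch_instance \<Rightarrow> nat \<Rightarrow> nat" where
  "t_max I i = Max (proc_time I ` jobs_of_class I i)"

definition T_min :: "batch_instance \<Rightarrow> real" where
  "T_min I = max (real (total_load I) / real (num_machines I))
     (real (Max ((\<lambda>i. setup_time I i + t_max I i) ` {..<num_classes I})))"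


section \<open>Preemptive schedules\<close>

text \<open>
  A schedule is a list of timed entries, each a complete setup of a class or a piece of a job.
  The processing order on a machine is the order in which its entries occur in the list.
\<close>

datatype activity = Setup nat | Piece nat

datatype entry = Entry (mach: nat) (start: real) (dur: real) (act: activity)

type_synonym schedule = "entry list"

definition finish :: "entry \<Rightarrow> real" where
  "finish e = start e + dur e"

fun activity_class :: "batch_instance \<Rightarrow> activity \<Rightarrow> nat" where
  "activity_class I (Setup i) = i"
| "activity_class I (Piece j) = class_of I j"

definition on_machine :: "schedule \<Rightarrow> nat \<Rightarrow> entry list" where
  "on_machine \<sigma> u = filter (\<lambda>e. mach e = u) \<sigma>"

fun legal_entry :: "batch_instance \<Rightarrow> entry \<Rightarrow> bool" where
  "legal_entry I (Entry u a d (Setup i)) \<longleftrightarrow>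
     u < num_machines I \<and> 0 \<le> a \<and> i < num_classes I \<and> d = real (setup_time I i)"
| "legal_entry I (Entry u a d (Piece j)) \<longleftrightarrow>
     u < num_machines I \<and> 0 \<le> a \<and> j < num_jobs I \<and> 0 < d"

text \<open>
  A machine may process a piece only directly after (up to idle time) a setup of its class or
  another piece of its class; in particular its first entry is a setup.
\<close>

definition setups_respected :: "batch_instance \<Rightarrow> entry list \<Rightarrow> bool" where
  "setups_respected I es \<longleftrightarrow>
     (\<forall>k<length es. \<forall>j. act (es ! k) = Piece j \<longrightarrow>
        0 < k \<and> activity_class I (act (es ! (k - 1))) = class_of I j)"

definition pmtn_feasible :: "batch_instance \<Rightarrow> schedule \<Rightarrow> bool" where
  "pmtn_feasible I \<sigma> \<longleftrightarrow>
     (\<forall>e\<in>set \<sigma>. legal_entry I e) \<and>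
     (\<forall>u<num_machines I.
        sorted_wrt (\<lambda>d e. finish d \<le> start e) (on_machine \<sigma> u) \<and>
        setups_respected I (on_machine \<sigma> u)) \<and>
     (\<forall>j<num_jobs I. (\<Sum>e\<leftarrow>filter (\<lambda>e. act e = Piece j) \<sigma>. dur e) = real (proc_time I j)) \<and>
     (\<forall>p<length \<sigma>. \<forall>q<length \<sigma>. \<forall>j.
        p \<noteq> q \<and> act (\<sigma> ! p) = Piece j \<and> act (\<sigma> ! q) = Piece j \<longrightarrow>
        finish (\<sigma> ! p) \<le> start (\<sigma> ! q) \<or> finish (\<sigma> ! q) \<le> start (\<sigma> ! p))"

definition makespan :: "schedule \<Rightarrow> real" where
  "makespan \<sigma> = Max (insert 0 (finish ` set \<sigma>))"

text \<open>The infimum is over a nonempty set, bounded below by 0, for every well-formed instance.\<close>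

definition OPT_pmtn :: "batch_instance \<Rightarrow> real" where
  "OPT_pmtn I = Inf (makespan ` {\<sigma>. pmtn_feasible I \<sigma>})"


section \<open>Expensive and cheap classes, nice instances\<close>

definition I_exp :: "batch_instance \<Rightarrow> real \<Rightarrow> nat set" where
  "I_exp I T = {i. i < num_classes I \<and> real (setup_time I i) > T / 2}"

definition I_chp :: "batch_instance \<Rightarrow> real \<Rightarrow> nat set" where
  "I_chp I T = {i. i < num_classes I \<and> \<not> real (setup_time I i) > T / 2}"

definition I_exp_plus :: "batch_instance \<Rightarrow> real \<Rightarrow> nat set" where
  "I_exp_plus I T =
     {i \<in> I_exp I T. T \<le> real (setup_time I i) + real (load I (jobs_of_class I i))}"

definition I_exp_zero :: "batch_instance \<Rightarrow> real \<Rightarrow> nat set" where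
  "I_exp_zero I T =
     {i \<in> I_exp I T. 3 / 4 * T < real (setup_time I i) + real (load I (jobs_of_class I i)) \<and>
        real (setup_time I i) + real (load I (jobs_of_class I i)) < T}"

definition I_exp_minus :: "batch_instance \<Rightarrow> real \<Rightarrow> nat set" where
  "I_exp_minus I T =
     {i \<in> I_exp I T. real (setup_time I i) + real (load I (jobs_of_class I i)) \<le> 3 / 4 * T}"

definition nice :: "batch_instance \<Rightarrow> real \<Rightarrow> bool" where
  "nice I T \<longleftrightarrow> I_exp_zero I T = {}"

definition alpha' :: "batch_instance \<Rightarrow> real \<Rightarrow> nat \<Rightarrow> nat" where
  "alpha' I T i =
     nat \<lfloor>real (load I (jobs_of_class I i)) / (T - real (setup_time I i))\<rfloor>"

definition L_nice :: "batch_instance \<Rightarrow> real \<Rightarrow> nat" where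
  "L_nice I T = load I {..<num_jobs I} + (\<Sum>i\<in>I_exp_plus I T. alpha' I T i * setup_time I i)
     + (\<Sum>i\<in>I_exp_minus I T \<union> I_chp I T. setup_time I i)"

definition m_nice :: "batch_instance \<Rightarrow> real \<Rightarrow> nat" where
  "m_nice I T = nat \<lceil>real (card (I_exp_minus I T)) / 2\<rceil> + (\<Sum>i\<in>I_exp_plus I T. alpha' I T i)"


section \<open>Model of computation\<close>

text \<open>
  Running time is measured on a unit-cost random access machine with a memory of naturals and a
  memory of reals (a real RAM), programmed in a structured while language.  Only naturals serve as
  addresses; naturals can be converted to reals, but there is no rounding of reals, and the only
  constants are naturals.  Both memories are split into named arrays; a program mentions only
  finitely many names, so this is an ordinary RAM with interleaved arrays, and scalar variables
  are arrays used at index 0.  Every node of an expression and every executed command costs one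
  step.
\<close>

datatype nexp =
    NConst nat
  | NGet string nexp
  | NAdd nexp nexp
  | NSub nexp nexp

datatype rexp =
    OfNat nexp
  | RGet string nexp
  | RAdd rexp rexp
  | RSub rexp rexp
  | RMul rexp rexp
  | RDiv rexp rexp

datatype bexp =
    NLess nexp nexp
  | RLess rexp rexp
  | BNot bexp
  | BAnd bexp bexp

datatype com =
    Skip
  | NSet string nexp nexp
  | RSet string nexp rexp
  | Seq com com
  | Cond bexp com com
  | While bexp com

record ram_state =
  nats :: "string \<Rightarrow> nat \<Rightarrow> nat"
  reals :: "string \<Rightarrow> nat \<Rightarrow> real"

primrec neval :: "nexp \<Rightarrow> ram_state \<Rightarrow> nat" where
  "neval (NConst k) s = k"
| "neval (NGet x a) s = nats s x (neval a s)"
| "neval (NAdd a b) s = neval a s + neval b s"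
| "neval (NSub a b) s = neval a s - neval b s"

primrec ncost :: "nexp \<Rightarrow> nat" where
  "ncost (NConst k) = 1"
| "ncost (NGet x a) = 1 + ncost a"
| "ncost (NAdd a b) = 1 + ncost a + ncost b"
| "ncost (NSub a b) = 1 + ncost a + ncost b"

primrec reval :: "rexp \<Rightarrow> ram_state \<Rightarrow> real" where
  "reval (OfNat a) s = real (neval a s)"
| "reval (RGet x a) s = reals s x (neval a s)"
| "reval (RAdd a b) s = reval a s + reval b s"
| "reval (RSub a b) s = reval a s - reval b s"
| "reval (RMul a b) s = reval a s * reval b s"
| "reval (RDiv a b) s = reval a s / reval b s"

primrec rcost :: "rexp \<Rightarrow> nat" where
  "rcost (OfNat a) = 1 + ncost a"
| "rcost (RGet x a) = 1 + ncost a"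
| "rcost (RAdd a b) = 1 + rcost a + rcost b"
| "rcost (RSub a b) = 1 + rcost a + rcost b"
| "rcost (RMul a b) = 1 + rcost a + rcost b"
| "rcost (RDiv a b) = 1 + rcost a + rcost b"

primrec beval :: "bexp \<Rightarrow> ram_state \<Rightarrow> bool" where
  "beval (NLess a b) s \<longleftrightarrow> neval a s < neval b s"
| "beval (RLess a b) s \<longleftrightarrow> reval a s < reval b s"
| "beval (BNot b) s \<longleftrightarrow> \<not> beval b s"
| "beval (BAnd a b) s \<longleftrightarrow> beval a s \<and> beval b s"

primrec bcost :: "bexp \<Rightarrow> nat" where
  "bcost (NLess a b) = 1 + ncost a + ncost b"
| "bcost (RLess a b) = 1 + rcost a + rcost b"
| "bcost (BNot b) = 1 + bcost b"
| "bcost (BAnd a b) = 1 + bcost a + bcost b"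

definition nat_update :: "string \<Rightarrow> nat \<Rightarrow> nat \<Rightarrow> ram_state \<Rightarrow> ram_state" where
  "nat_update x k v s = s\<lparr>nats := (nats s)(x := (nats s x)(k := v))\<rparr>"

definition real_update :: "string \<Rightarrow> nat \<Rightarrow> real \<Rightarrow> ram_state \<Rightarrow> ram_state" where
  "real_update x k v s = s\<lparr>reals := (reals s)(x := (reals s x)(k := v))\<rparr>"

text \<open>\<open>exec c s k s'\<close>: started in \<open>s\<close>, the program \<open>c\<close> halts in \<open>s'\<close> after exactly \<open>k\<close> steps.\<close>

inductive exec :: "com \<Rightarrow> ram_state \<Rightarrow> nat \<Rightarrow> ram_state \<Rightarrow> bool" where
  Skip: "exec Skip s 1 s"
| NSet: "exec (NSet x a e) s (1 + ncost a + ncost e) (nat_update x (neval a s) (neval e s) s)"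
| RSet: "exec (RSet x a e) s (1 + ncost a + rcost e) (real_update x (neval a s) (reval e s) s)"
| Seq: "exec c s k s' \<Longrightarrow> exec d s' l s'' \<Longrightarrow> exec (Seq c d) s (1 + k + l) s''"
| CondTrue: "beval b s \<Longrightarrow> exec c s k s' \<Longrightarrow> exec (Cond b c d) s (1 + bcost b + k) s'"
| CondFalse: "\<not> beval b s \<Longrightarrow> exec d s k s' \<Longrightarrow> exec (Cond b c d) s (1 + bcost b + k) s'"
| WhileFalse: "\<not> beval b s \<Longrightarrow> exec (While b c) s (1 + bcost b) s"
| WhileTrue: "beval b s \<Longrightarrow> exec c s k s' \<Longrightarrow> exec (While b c) s' l s'' \<Longrightarrow>
    exec (While b c) s (1 + bcost b + k + l) s''"

text \<open>Input and output conventions; all cells not holding input are initially 0.\<close>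

definition input_state :: "batch_instance \<Rightarrow> real \<Rightarrow> ram_state" where
  "input_state I T = \<lparr>
     nats = (\<lambda>x k.
       if x = ''m'' \<and> k = 0 then num_machines I
       else if x = ''n'' \<and> k = 0 then num_jobs I
       else if x = ''c'' \<and> k = 0 then num_classes I
       else if x = ''class'' \<and> k < num_jobs I then class_of I k
       else 0),
     reals = (\<lambda>x k.
       if x = ''T'' \<and> k = 0 then T
       else if x = ''s'' \<and> k < num_classes I then real (setup_time I k)
       else if x = ''t'' \<and> k < num_jobs I then real (proc_time I k)
       else 0)\<rparr>"

definition output_schedule :: "ram_state \<Rightarrow> schedule" where
  "output_schedule s =
     map (\<lambda>k. Entry (nats s ''machine'' k) (reals s ''start'' k) (reals s ''duration'' k)
            (if nats s ''kind'' k = 0 then Setup (nats s ''id'' k) else Piece (nats s ''id'' k)))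
       [0..<nats s ''entries'' 0]"

end

theory Submission
  imports Defs
begin

text \<open>
  Lower bound: in a schedule of makespan at most \<open>B\<close>, a machine with \<open>k \<ge> 1\<close> setups of class \<open>i\<close>
  processes at most \<open>k (B - s\<^sub>i)\<close> of its load, and carries at most one setup exceeding \<open>B / 2\<close>.
  Summing over the machines yields both bounds for \<open>B = T\<close>.  As finitely many strict inequalities
  are involved, they still hold for some \<open>B > T\<close>, which gives the strict inequality for the infimum.

  Schedule: each class in \<open>I\<^sub>e\<^sub>x\<^sub>p\<^sup>+\<close> is wrapped around \<open>\<alpha>'\<close> machines, each offering
  the room \<open>P(C\<^sub>i) / \<alpha>' \<in> [T - s\<^sub>i, 2 (T - s\<^sub>i))\<close> after the setup; the classes in \<open>I\<^sub>e\<^sub>x\<^sub>p\<^sup>-\<close>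
  are paired; the cheap classes are wrapped around the gaps \<open>[T/2, 3T/2]\<close> of the remaining machines
  (and \<open>[T, 3T/2]\<close> of an unpaired machine), a continued class being set up just before the gap.
  A job is cut at most once, and its two pieces do not overlap because it is no longer than the gap.
  The expensive classes load their machines with at least \<open>T\<close> on average (with more than \<open>T/2\<close> for
  the unpaired one, whose gap has length \<open>T/2\<close>), so \<open>L\<^sub>n\<^sub>i\<^sub>c\<^sub>e \<le> m T\<close> shows that the gaps suffice.
\<close>

section \<open>Schedules built entry by entry\<close>

definition current :: "batch_instance \<Rightarrow> schedule \<Rightarrow> nat \<Rightarrow> nat \<Rightarrow> bool" where
  "current I \<sigma> u i \<longleftrightarrow>
     on_machine \<sigma> u \<noteq> [] \<and> activity_class I (act (last (on_machine \<sigma> u))) = i"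

definition no_overlap :: "entry \<Rightarrow> entry \<Rightarrow> bool" where
  "no_overlap d e \<longleftrightarrow> (\<forall>j. act d = Piece j \<and> act e = Piece j \<longrightarrow>
     finish d \<le> start e \<or> finish e \<le> start d)"

definition in_order :: "entry \<Rightarrow> entry \<Rightarrow> bool" where
  "in_order d e \<longleftrightarrow> (mach d = mach e \<longrightarrow> finish d \<le> start e)"

text \<open>Feasibility without the completeness of jobs. Both order conditions are pairwise
  relations along the whole list, so a new last entry only has to be compared with the earlier
  ones.\<close>

definition valid :: "batch_instance \<Rightarrow> schedule \<Rightarrow> bool" where
  "valid I \<sigma> \<longleftrightarrow> (\<forall>e\<in>set \<sigma>. legal_entry I e) \<and> sorted_wrt in_order \<sigma> \<and>
     sorted_wrt no_overlap \<sigma> \<and> (\<forall>u. setups_respected I (on_machine \<sigma> u))"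

definition job_time :: "schedule \<Rightarrow> nat \<Rightarrow> real" where
  "job_time \<sigma> j = (\<Sum>e\<leftarrow>filter (\<lambda>e. act e = Piece j) \<sigma>. dur e)"

lemma setups_respected_snoc:
  assumes "setups_respected I es"
    and "\<And>j. act e = Piece j \<Longrightarrow> es \<noteq> [] \<and> activity_class I (act (last es)) = class_of I j"
  shows "setups_respected I (es @ [e])"
  unfolding setups_respected_def
proof (intro allI impI)
  fix k j
  assume k: "k < length (es @ [e])" and j: "act ((es @ [e]) ! k) = Piece j"
  show "0 < k \<and> activity_class I (act ((es @ [e]) ! (k - 1))) = class_of I j"
  proof (cases "k < length es")
    case True
    then show ?thesis using assms(1) j unfolding setups_respected_def
      by (auto simp: nth_append)
  next
    case False
    then have "k = length es" using k by simp
    then show ?thesis using assms(2)[of j] j by (auto simp: nth_append last_conv_nth)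
  qed
qed

lemma on_machine_snoc:
  "on_machine (\<sigma> @ [e]) u = on_machine \<sigma> u @ (if mach e = u then [e] else [])"
  by (simp add: on_machine_def)

lemma current_snoc: "current I (\<sigma> @ [e]) (mach e) (activity_class I (act e))"
  by (simp add: current_def on_machine_snoc)

lemma valid_snoc:
  assumes "valid I \<sigma>" "legal_entry I e"
    and "\<And>d. d \<in> set \<sigma> \<Longrightarrow> mach d = mach e \<Longrightarrow> finish d \<le> start e"
    and "\<And>d. d \<in> set \<sigma> \<Longrightarrow> no_overlap d e"
    and "\<And>j. act e = Piece j \<Longrightarrow> current I \<sigma> (mach e) (class_of I j)"
  shows "valid I (\<sigma> @ [e])"
  unfolding valid_def
proof (intro conjI allI)
  show "\<forall>e\<in>set (\<sigma> @ [e]). legal_entry I e"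
    using assms(1,2) by (auto simp: valid_def)
  show "sorted_wrt in_order (\<sigma> @ [e])" "sorted_wrt no_overlap (\<sigma> @ [e])"
    using assms by (auto simp: valid_def sorted_wrt_append in_order_def)
  fix u
  have "setups_respected I (on_machine \<sigma> u)" using assms(1) by (simp add: valid_def)
  then show "setups_respected I (on_machine (\<sigma> @ [e]) u)"
    using assms(5) by (auto simp: on_machine_snoc current_def intro!: setups_respected_snoc)
qed

lemma valid_feasible:
  assumes "valid I \<sigma>" and "\<And>j. j < num_jobs I \<Longrightarrow> job_time \<sigma> j = real (proc_time I j)"
  shows "pmtn_feasible I \<sigma>"
proof -
  have "sorted_wrt (\<lambda>d e. finish d \<le> start e) (on_machine \<sigma> u)" for u
  proof (rule sorted_wrt_mono_rel)
    show "sorted_wrt in_order (on_machine \<sigma> u)"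
      using assms(1) unfolding on_machine_def valid_def by (auto intro: sorted_wrt_filter)
  qed (auto simp: on_machine_def in_order_def)
  moreover have "finish (\<sigma> ! p) \<le> start (\<sigma> ! q) \<or> finish (\<sigma> ! q) \<le> start (\<sigma> ! p)"
    if "p < length \<sigma>" "q < length \<sigma>" "p \<noteq> q" "act (\<sigma> ! p) = Piece j" "act (\<sigma> ! q) = Piece j"
    for p q j
  proof -
    have "no_overlap (\<sigma> ! a) (\<sigma> ! b)" if "a < b" "b < length \<sigma>" for a b
      using assms(1) that by (simp add: valid_def sorted_wrt_iff_nth_less)
    then show ?thesis using that unfolding no_overlap_def by (metis linorder_neqE_nat)
  qed
  ultimately show ?thesis
    using assms unfolding pmtn_feasible_def valid_def job_time_def by auto
qed

text \<open>\<open>D\<close> collects the jobs that are placed completely, so the invariant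
  describes the moments between two jobs; a cut is confined to a single \<open>job_step\<close>. No
  entry lies beyond machine \<open>u\<close>, so the next machine is empty.\<close>

definition partial_schedule ::
    "batch_instance \<Rightarrow> real \<Rightarrow> nat set \<Rightarrow> nat \<times> real \<times> schedule \<Rightarrow> bool" where
  "partial_schedule I B D = (\<lambda>(u, p, \<sigma>). valid I \<sigma> \<and> 0 \<le> p \<and>
     (\<forall>e\<in>set \<sigma>. (mach e < u \<or> mach e = u \<and> finish e \<le> p) \<and> finish e \<le> B) \<and>
     (\<forall>e\<in>set \<sigma>. \<forall>j. act e = Piece j \<longrightarrow> j \<in> D) \<and>
     (\<forall>j. job_time \<sigma> j = (if j \<in> D then real (proc_time I j) else 0)))"

text \<open>
  A state \<open>(u, p, \<sigma>)\<close> consists of the current machine, the time from which it is free and the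
  entries so far.  When load reaches the limit \<open>l\<close>, it continues at time \<open>b\<close> on the next machine, after
  a setup in \<open>[b - s\<^sub>i, b]\<close>.  The potential \<open>u * (l - b) + p\<close> grows by exactly the load placed, and by
  at most \<open>s\<^sub>i\<close> in a setup step; it bounds the number of machines.
\<close>

fun setup_step :: "batch_instance \<Rightarrow> nat \<Rightarrow> real \<Rightarrow> real \<Rightarrow> nat \<times> real \<times> schedule
    \<Rightarrow> nat \<times> real \<times> schedule" where
  "setup_step I i b l (u, p, \<sigma>) = (let s = real (setup_time I i) in
     if l < p + s then (u + 1, b, \<sigma> @ [Entry (u + 1) (b - s) s (Setup i)])
     else (u, p + s, \<sigma> @ [Entry u p s (Setup i)]))"

fun job_step :: "batch_instance \<Rightarrow> nat \<Rightarrow> real \<Rightarrow> real \<Rightarrow> nat \<Rightarrow> nat \<times> real \<times> schedule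
    \<Rightarrow> nat \<times> real \<times> schedule" where
  "job_step I i b l j (u, p, \<sigma>) = (let s = real (setup_time I i); t = real (proc_time I j) in
     if l < p + t then
       (u + 1, b + (p + t - l),
        (if p < l then \<sigma> @ [Entry u p (l - p) (Piece j)] else \<sigma>) @
          [Entry (u + 1) (b - s) s (Setup i)] @ [Entry (u + 1) b (p + t - l) (Piece j)])
     else (u, p + t, \<sigma> @ [Entry u p t (Piece j)]))"

lemma job_time_snoc:
  "job_time (\<sigma> @ [e]) j = job_time \<sigma> j + (if act e = Piece j then dur e else 0)"
  by (simp add: job_time_def)

text \<open>Work past the base \<open>b\<close> on machine \<open>u\<close> lifts the potential
  above \<open>real u * g + b\<close>; a budget of \<open>M\<close> gaps of length \<open>g\<close>
  therefore keeps \<open>u\<close> below \<open>M\<close>.\<close>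

lemma potential_less:
  fixes g p b :: real
  assumes "real u * g + p \<le> real M * g + b" "b < p" "0 < g"
  shows "u < M"
proof -
  have "real u * g < real M * g" using assms by linarith
  then show ?thesis using assms(3) by simp
qed

text \<open>\<open>t\<close> stands for the load that is to follow the setup. If the setup opens a
  new machine, \<open>p'\<close> equals \<open>b\<close>, and only this load makes the potential
  exceed the base strictly, as \<open>potential_less\<close> requires. Opening a machine raises the
  potential by \<open>l - p\<close>, which is then less than the setup time.\<close>

lemma setup_step_partial:
  fixes b l p :: real
  assumes inv: "partial_schedule I B D (u, p, \<sigma>)" and i: "i < num_classes I"
    and b: "real (setup_time I i) \<le> b" "b < l" "l \<le> B" "b \<le> p + real (setup_time I i)"
    and t: "real u * (l - b) + p + real (setup_time I i) + t \<le> real M * (l - b) + b" "0 < t"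
    and M: "M \<le> num_machines I"
    and res: "setup_step I i b l (u, p, \<sigma>) = (u', p', \<sigma>')"
  shows "partial_schedule I B D (u', p', \<sigma>')" "current I \<sigma>' u' i" "b \<le> p'" "p' \<le> l" "u \<le> u'"
    "real u' * (l - b) + p' \<le> real u * (l - b) + p + real (setup_time I i)"
    "u' = u \<Longrightarrow> p' = p + real (setup_time I i)"
proof -
  define s where "s = real (setup_time I i)"
  have inv': "valid I \<sigma>" "0 \<le> p" "\<And>e. e \<in> set \<sigma> \<Longrightarrow> mach e < u \<or> mach e = u \<and> finish e \<le> p"
    "\<And>e. e \<in> set \<sigma> \<Longrightarrow> finish e \<le> B" "\<And>e j. e \<in> set \<sigma> \<Longrightarrow> act e = Piece j \<Longrightarrow> j \<in> D"
    "\<And>j. job_time \<sigma> j = (if j \<in> D then real (proc_time I j) else 0)"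
    using inv by (auto simp: partial_schedule_def)
  have s: "0 \<le> s" "s \<le> b" using b by (auto simp: s_def)
  have u'M: "real u' * (l - b) + p' \<le> real u * (l - b) + p + s \<and> b \<le> p' \<and> p' \<le> l \<and> u \<le> u' \<and>
    (u' = u \<longrightarrow> p' = p + s)"
    using res b by (auto simp: Let_def s_def algebra_simps split: if_splits)
  have "u' < M"
    by (rule potential_less[of _ "l - b" "p' + t" _ b])
      (use u'M t b in \<open>auto simp: s_def\<close>)
  then have u': "u' < num_machines I" using M by simp
  \<comment> \<open>Both branches of \<open>setup_step\<close> let the setup end at the new time
    \<open>p'\<close>, so its start has one formula.\<close>
  define a where "a = p' - s"
  have a: "\<sigma>' = \<sigma> @ [Entry u' a s (Setup i)]" "0 \<le> a" "a + s = p'" "u' = u \<longrightarrow> p \<le> a"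
    using res s inv'(2) by (auto simp: a_def Let_def s_def split: if_splits)
  have "valid I \<sigma>'"
    unfolding a(1)
    by (rule valid_snoc[OF inv'(1)])
      (use a(2,4) i u' u'M inv'(3) in \<open>fastforce simp: s_def no_overlap_def\<close>)+
  moreover have "mach e < u' \<or> mach e = u' \<and> finish e \<le> p'" "finish e \<le> B" if "e \<in> set \<sigma>'" for e
    using that inv'(3)[of e] inv'(4)[of e] a u'M s b(3) by (auto simp: finish_def)
  ultimately show "partial_schedule I B D (u', p', \<sigma>')"
    using inv'(5,6) a(1) u'M s by (auto simp: partial_schedule_def job_time_snoc)
  show "current I \<sigma>' u' i"
    using current_snoc[of I \<sigma> "Entry u' a s (Setup i)"] a(1) by simp
  show "b \<le> p'" "p' \<le> l" "u \<le> u'"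
    "real u' * (l - b) + p' \<le> real u * (l - b) + p + real (setup_time I i)"
    "u' = u \<Longrightarrow> p' = p + real (setup_time I i)"
    using u'M by (auto simp: s_def)
qed

text \<open>A cut job of length \<open>t\<close> occupies \<open>[p, l]\<close> and, on the next
  machine, \<open>[b, b + (p + t - l)]\<close>. Since it fits into one gap,
  \<open>t \<le> l - b\<close>, the second piece ends by time \<open>p\<close>; hence the pieces are
  disjoint in time and one cut suffices. The new setup lies below \<open>b\<close>, outside the gap,
  so the potential grows by \<open>t\<close> exactly.\<close>

lemma job_step_partial:
  fixes b l p :: real
  assumes inv: "partial_schedule I B D (u, p, \<sigma>)" and cur: "current I \<sigma> u i"
    and j: "j < num_jobs I" "class_of I j = i" "i < num_classes I" "j \<notin> D" "0 < proc_time I j"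
    and b: "real (setup_time I i) \<le> b" "b < l" "l \<le> B" "b \<le> p" "p \<le> l"
      "b + real (proc_time I j) \<le> l"
    and t: "real u * (l - b) + p + real (proc_time I j) \<le> real M * (l - b) + b"
    and M: "M \<le> num_machines I"
    and res: "job_step I i b l j (u, p, \<sigma>) = (u', p', \<sigma>')"
  shows "partial_schedule I B (insert j D) (u', p', \<sigma>')" "current I \<sigma>' u' i" "b < p'" "p' \<le> l"
    "u \<le> u'" "real u' * (l - b) + p' = real u * (l - b) + p + real (proc_time I j)"
    "u' = u \<Longrightarrow> p < p'" "u' < M"
proof -
  define s t where "s = real (setup_time I i)" and "t = real (proc_time I j)"
  have inv': "valid I \<sigma>" "0 \<le> p" "\<And>e. e \<in> set \<sigma> \<Longrightarrow> mach e < u \<or> mach e = u \<and> finish e \<le> p"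
    "\<And>e. e \<in> set \<sigma> \<Longrightarrow> finish e \<le> B" "\<And>e j. e \<in> set \<sigma> \<Longrightarrow> act e = Piece j \<Longrightarrow> j \<in> D"
    "\<And>j. job_time \<sigma> j = (if j \<in> D then real (proc_time I j) else 0)"
    using inv by (auto simp: partial_schedule_def)
  have s: "0 \<le> s" "s \<le> b" "0 < t" using b j(5) by (auto simp: s_def t_def)
  have pos: "real u' * (l - b) + p' = real u * (l - b) + p + t \<and> b < p' \<and> p' \<le> l \<and> u \<le> u' \<and>
    (u' = u \<longrightarrow> p < p')"
    using res b s by (auto simp: Let_def s_def t_def algebra_simps split: if_splits)
  show u'M: "u' < M"
    by (rule potential_less[of _ "l - b" p' _ b])
      (use pos t b in \<open>auto simp: t_def\<close>)
  then have u': "u' < num_machines I" "u < num_machines I" using M pos by simp_all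
  have part: "valid I (\<sigma> @ [Entry u p d (Piece j)])" if "0 < d" for d
    by (rule valid_snoc[OF inv'(1)])
      (use that u' j inv' cur in \<open>fastforce simp: no_overlap_def\<close>)+
  have nj: "no_overlap e (Entry v a d (Piece j))" if "e \<in> set \<sigma>" for e v a d
    using inv'(5)[OF that] j(4) by (auto simp: no_overlap_def)
  have "partial_schedule I B (insert j D) (u', p', \<sigma>') \<and> current I \<sigma>' u' i"
  proof (cases "l < p + t")
    case False
    then have r: "u' = u" "p' = p + t" "\<sigma>' = \<sigma> @ [Entry u p t (Piece j)]"
      using res by (auto simp: Let_def t_def)
    have "current I \<sigma>' u' i"
      using current_snoc[of I \<sigma> "Entry u p t (Piece j)"] r j by simp
    moreover have "partial_schedule I B (insert j D) (u', p', \<sigma>')"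
      using part[OF s(3)] inv' j r s False b(3)
      by (fastforce simp: partial_schedule_def job_time_snoc t_def finish_def)
    ultimately show ?thesis by simp
  next
    case True
    \<comment> \<open>For \<open>p = l\<close> the gap is used up, and a first piece would have the
      illegal duration 0.\<close>
    define \<sigma>1 where "\<sigma>1 = (if p < l then \<sigma> @ [Entry u p (l - p) (Piece j)] else \<sigma>)"
    define e2 where "e2 = Entry (u + 1) (b - s) s (Setup i)"
    define e3 where "e3 = Entry (u + 1) b (p + t - l) (Piece j)"
    have r: "u' = u + 1" "p' = b + (p + t - l)" "\<sigma>' = (\<sigma>1 @ [e2]) @ [e3]"
      using True res by (auto simp: Let_def t_def s_def \<sigma>1_def e2_def e3_def)
    have in1: "e \<in> set \<sigma> \<or> (e = Entry u p (l - p) (Piece j) \<and> p < l)" if "e \<in> set \<sigma>1" for e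
      using that by (auto simp: \<sigma>1_def split: if_splits)
    have v1: "valid I \<sigma>1" using part[of "l - p"] inv'(1) by (auto simp: \<sigma>1_def)
    have m1: "mach e \<le> u" if "e \<in> set \<sigma>1" for e
      using in1[OF that] inv'(3)[of e] by auto
    have v2: "valid I (\<sigma>1 @ [e2])"
      by (rule valid_snoc[OF v1])
        (use m1 u' r s j in \<open>fastforce simp: e2_def s_def no_overlap_def\<close>)+
    have c2: "current I (\<sigma>1 @ [e2]) (u + 1) i"
      using current_snoc[of I \<sigma>1 e2] by (simp add: e2_def)
    have le: "b + (p + t - l) \<le> p" using b(6) by (simp add: t_def)
    have v3: "valid I \<sigma>'"
      unfolding r(3)
    proof (rule valid_snoc[OF v2])
      show "legal_entry I e3" using u' r s True j by (simp add: e3_def)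
      show "finish d \<le> start e3" if "d \<in> set (\<sigma>1 @ [e2])" "mach d = mach e3" for d
        using that m1[of d] by (auto simp: e3_def e2_def finish_def)
      show "no_overlap d e3" if "d \<in> set (\<sigma>1 @ [e2])" for d
      proof (cases "d \<in> set \<sigma>")
        case True
        then show ?thesis using nj by (simp add: e3_def)
      next
        case False
        then have "d = e2 \<or> d = Entry u p (l - p) (Piece j)" using that in1[of d] by auto
        then show ?thesis using le by (auto simp: e3_def e2_def no_overlap_def finish_def)
      qed
      show "current I (\<sigma>1 @ [e2]) (mach e3) (class_of I k)" if "act e3 = Piece k" for k
        using that c2 j by (simp add: e3_def)
    qed
    have "current I \<sigma>' u' i"
      using current_snoc[of I "\<sigma>1 @ [e2]" e3] r(1,3) j by (simp add: e3_def)
    moreover have "(mach e < u' \<or> mach e = u' \<and> finish e \<le> p') \<and> finish e \<le> B \<and>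
        (\<forall>k. act e = Piece k \<longrightarrow> k \<in> insert j D)" if "e \<in> set \<sigma>'" for e
      using that in1[of e] inv'(3-5)[of e] r pos b s
      by (auto simp: e2_def e3_def finish_def)
    moreover have "job_time \<sigma>' k = (if k \<in> insert j D then real (proc_time I k) else 0)" for k
      using inv'(6)[of k] j(4) b(5)
      by (auto simp: r(3) job_time_def e2_def e3_def \<sigma>1_def t_def)
    ultimately show ?thesis
      using v3 pos s by (auto simp: partial_schedule_def)
  qed
  then show "partial_schedule I B (insert j D) (u', p', \<sigma>')" "current I \<sigma>' u' i" by simp_all
  show "b < p'" "p' \<le> l" "u \<le> u'"
    "real u' * (l - b) + p' = real u * (l - b) + p + real (proc_time I j)" "u' = u \<Longrightarrow> p < p'"
    using pos by (auto simp: t_def)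
qed

text \<open>The strict conclusions rest on \<open>js\<close> being nonempty: right after a setup
  \<open>p\<close> may equal \<open>b\<close>, and with nothing to follow the budget would allow
  \<open>u = M\<close>.\<close>

lemma job_steps_partial:
  fixes b l p :: real
  assumes "partial_schedule I B D (u, p, \<sigma>)" "current I \<sigma> u i"
    and "distinct js" "set js \<inter> D = {}" "i < num_classes I"
    and "\<And>j. j \<in> set js \<Longrightarrow> j < num_jobs I \<and> class_of I j = i \<and> 0 < proc_time I j \<and>
      b + real (proc_time I j) \<le> l"
    and "real (setup_time I i) \<le> b" "b < l" "l \<le> B" "b \<le> p" "p \<le> l"
    and "real u * (l - b) + p + (\<Sum>j\<leftarrow>js. real (proc_time I j)) \<le> real M * (l - b) + b"
    and "M \<le> num_machines I"
    and "fold (job_step I i b l) js (u, p, \<sigma>) = (u', p', \<sigma>')"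
    and "js \<noteq> []"
  shows "partial_schedule I B (D \<union> set js) (u', p', \<sigma>') \<and> b < p' \<and> p' \<le> l \<and> u \<le> u' \<and>
    real u' * (l - b) + p' = real u * (l - b) + p + (\<Sum>j\<leftarrow>js. real (proc_time I j)) \<and>
    (u' = u \<longrightarrow> p < p') \<and> u' < M"
  using assms
proof (induction js arbitrary: u p \<sigma> D)
  case Nil
  then show ?case by simp
next
  case (Cons j js)
  obtain u1 p1 \<sigma>1 where r1: "job_step I i b l j (u, p, \<sigma>) = (u1, p1, \<sigma>1)"
    by (metis prod_cases3)
  have nn: "0 \<le> (\<Sum>j\<leftarrow>js. real (proc_time I j))" by (intro sum_list_nonneg) auto
  then have bound: "real u * (l - b) + p + real (proc_time I j) \<le> real M * (l - b) + b"
    using Cons.prems(12) by simp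
  have jc: "j < num_jobs I" "class_of I j = i" "j \<notin> D" "0 < proc_time I j"
    "b + real (proc_time I j) \<le> l" using Cons.prems(4,6) by auto
  note st = job_step_partial[OF Cons.prems(1,2) jc(1,2) Cons.prems(5) jc(3,4) Cons.prems(7-11)
      jc(5) bound Cons.prems(13) r1]
  show ?case
  proof (cases "js = []")
    case True
    then show ?thesis using st r1 Cons.prems(14) by auto
  next
    case False
    have "partial_schedule I B (insert j D \<union> set js) (u', p', \<sigma>') \<and> b < p' \<and> p' \<le> l \<and> u1 \<le> u' \<and>
      real u' * (l - b) + p' = real u1 * (l - b) + p1 + (\<Sum>j\<leftarrow>js. real (proc_time I j)) \<and>
      (u' = u1 \<longrightarrow> p1 < p') \<and> u' < M"
      by (rule Cons.IH[OF st(1,2)])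
        (use False st Cons.prems r1 in \<open>auto simp: less_imp_le\<close>)
    then show ?thesis using st by (auto simp: algebra_simps)
  qed
qed

definition run_class :: "batch_instance \<Rightarrow> nat \<Rightarrow> real \<Rightarrow> real \<Rightarrow> nat list \<Rightarrow> nat \<times> real \<times> schedule
    \<Rightarrow> nat \<times> real \<times> schedule" where
  "run_class I i b l js a = fold (job_step I i b l) js (setup_step I i b l a)"

text \<open>The budget pays for the load of the class and for a single setup; all further setups of
  the class lie below \<open>b\<close> and are free in the potential.\<close>

lemma run_class_partial:
  fixes b l p :: real
  assumes "partial_schedule I B D (u, p, \<sigma>)"
    and "distinct js" "set js \<inter> D = {}" "i < num_classes I" "js \<noteq> []"
    and "\<And>j. j \<in> set js \<Longrightarrow> j < num_jobs I \<and> class_of I j = i \<and> 0 < proc_time I j \<and>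
      b + real (proc_time I j) \<le> l"
    and "real (setup_time I i) \<le> b" "b < l" "l \<le> B" "b \<le> p + real (setup_time I i)"
    and bound: "real u * (l - b) + p + real (setup_time I i) + (\<Sum>j\<leftarrow>js. real (proc_time I j))
      \<le> real M * (l - b) + b"
    and "M \<le> num_machines I"
    and res: "run_class I i b l js (u, p, \<sigma>) = (u', p', \<sigma>')"
  shows "partial_schedule I B (D \<union> set js) (u', p', \<sigma>')" "b < p'" "p' \<le> l" "u \<le> u'"
    "real u' * (l - b) + p' \<le>
      real u * (l - b) + p + real (setup_time I i) + (\<Sum>j\<leftarrow>js. real (proc_time I j))"
    "u' = u \<Longrightarrow> p + real (setup_time I i) < p'" "u' < M"
proof -
  obtain u1 p1 \<sigma>1 where r1: "setup_step I i b l (u, p, \<sigma>) = (u1, p1, \<sigma>1)"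
    by (metis prod_cases3)
  have "0 < (\<Sum>j\<leftarrow>js. real (proc_time I j))"
    using assms(5,6) by (cases js) (auto intro!: add_pos_nonneg sum_list_nonneg)
  note st = setup_step_partial[OF assms(1,4,7,8,9,10) bound this assms(12) r1]
  have "partial_schedule I B (D \<union> set js) (u', p', \<sigma>') \<and> b < p' \<and> p' \<le> l \<and> u1 \<le> u' \<and>
    real u' * (l - b) + p' = real u1 * (l - b) + p1 + (\<Sum>j\<leftarrow>js. real (proc_time I j)) \<and>
    (u' = u1 \<longrightarrow> p1 < p') \<and> u' < M"
    by (rule job_steps_partial[OF st(1,2)])
      (use st assms r1 in \<open>auto simp: run_class_def\<close>)
  then show "partial_schedule I B (D \<union> set js) (u', p', \<sigma>')" "b < p'" "p' \<le> l" "u \<le> u'"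
    "real u' * (l - b) + p' \<le>
      real u * (l - b) + p + real (setup_time I i) + (\<Sum>j\<leftarrow>js. real (proc_time I j))"
    "u' = u \<Longrightarrow> p + real (setup_time I i) < p'" "u' < M"
    using st by auto
qed

section \<open>The three passes\<close>

abbreviation stime :: "batch_instance \<Rightarrow> nat \<Rightarrow> real" where
  "stime I i \<equiv> real (setup_time I i)"

abbreviation class_load :: "batch_instance \<Rightarrow> nat \<Rightarrow> real" where
  "class_load I i \<equiv> real (load I (jobs_of_class I i))"

text \<open>The order is reversed because the program builds the list of a class by prepending its
  jobs in increasing order.\<close>

definition class_jobs :: "batch_instance \<Rightarrow> nat \<Rightarrow> nat list" where
  "class_jobs I i = rev (filter (\<lambda>j. class_of I j = i) [0..<num_jobs I])"

lemma set_class_jobs: "set (class_jobs I i) = jobs_of_class I i"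
  by (auto simp: class_jobs_def jobs_of_class_def)

lemma distinct_class_jobs: "distinct (class_jobs I i)"
  by (simp add: class_jobs_def)

lemma length_class_jobs: "length (class_jobs I i) = card (jobs_of_class I i)"
  by (metis set_class_jobs distinct_class_jobs distinct_card)

lemma sum_class_jobs: "(\<Sum>j\<leftarrow>class_jobs I i. real (proc_time I j)) = class_load I i"
  by (simp add: load_def sum_list_distinct_conv_sum_set distinct_class_jobs set_class_jobs)

lemma finite_jobs_of_class [simp]: "finite (jobs_of_class I i)"
  by (simp add: jobs_of_class_def)

lemma sum_jobs_by_class:
  assumes "wf_instance I"
  shows "(\<Sum>j<num_jobs I. f j) = (\<Sum>i<num_classes I. \<Sum>j\<in>jobs_of_class I i. f j)"
proof -
  have "(\<Sum>j<num_jobs I. f j) =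
      (\<Sum>i<num_classes I. \<Sum>j\<in>{j \<in> {..<num_jobs I}. class_of I j = i}. f j)"
    by (rule sum.group[symmetric]) (use assms in \<open>auto simp: wf_instance_def\<close>)
  then show ?thesis by (simp add: jobs_of_class_def)
qed

lemma load_by_class:
  assumes "wf_instance I"
  shows "load I {..<num_jobs I} = (\<Sum>i<num_classes I. load I (jobs_of_class I i))"
  by (simp add: load_def sum_jobs_by_class[OF assms])

lemma sum_card_classes:
  assumes "wf_instance I"
  shows "(\<Sum>i<num_classes I. card (jobs_of_class I i)) = num_jobs I"
  using sum_jobs_by_class[OF assms, of "\<lambda>_. 1 :: nat"] by simp

section \<open>Consequences of \<open>T_min I \<le> T\<close>\<close>

locale bounded_instance =
  fixes I :: batch_instance and T :: real
  assumes wf: "wf_instance I" and T_min_le: "T_min I \<le> T"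
begin

abbreviation n where "n \<equiv> num_jobs I"
abbreviation c where "c \<equiv> num_classes I"
abbreviation m where "m \<equiv> num_machines I"

lemma job_class: "j < n \<Longrightarrow> class_of I j < c" and job_pos: "j < n \<Longrightarrow> 0 < proc_time I j"
  using wf by (auto simp: wf_instance_def)

lemma class_jobs_ne: "i < c \<Longrightarrow> jobs_of_class I i \<noteq> {}"
  using wf by (auto simp: wf_instance_def)

text \<open>The second term of \<open>T_min\<close> bounds every job by
  \<open>T - stime I i\<close>, and each gap used below for class \<open>i\<close> is at least that
  long.\<close>

lemma setup_job_le:
  assumes "j \<in> jobs_of_class I i"
  shows "stime I i + real (proc_time I j) \<le> T"
proof -
  have i: "i < c" using assms job_class by (auto simp: jobs_of_class_def)
  have "proc_time I j \<le> t_max I i"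
    using assms by (simp add: t_max_def)
  also have "setup_time I i + t_max I i \<le> Max ((\<lambda>i. setup_time I i + t_max I i) ` {..<c})"
    using i by (intro Max_ge) auto
  finally have "real (setup_time I i + proc_time I j) \<le>
      real (Max ((\<lambda>i. setup_time I i + t_max I i) ` {..<c}))"
    by simp
  also have "\<dots> \<le> T" using T_min_le by (simp add: T_min_def)
  finally show ?thesis by simp
qed

lemma total_load_le: "real (total_load I) \<le> real m * T"
proof -
  have "real (total_load I) / real m \<le> T" using T_min_le by (simp add: T_min_def)
  moreover have "0 < m" using wf by (simp add: wf_instance_def)
  ultimately show ?thesis by (simp add: field_simps)
qed

lemma setup_less: "i < c \<Longrightarrow> stime I i < T"
  using class_jobs_ne setup_job_le job_pos
  by (fastforce simp: jobs_of_class_def)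

lemma T_pos: "0 < T"
proof -
  have "0 < n" using wf by (simp add: wf_instance_def)
  then have "0 \<in> jobs_of_class I (class_of I 0)" by (simp add: jobs_of_class_def)
  from setup_job_le[OF this] job_pos[OF \<open>0 < n\<close>] show ?thesis by linarith
qed

lemma class_load_pos:
  assumes "i < c"
  shows "0 < class_load I i"
proof -
  obtain j where "j \<in> jobs_of_class I i" using class_jobs_ne[OF assms] by auto
  then have "0 < proc_time I j" "proc_time I j \<le> load I (jobs_of_class I i)"
    using job_pos by (auto simp: jobs_of_class_def load_def intro!: member_le_sum)
  then show ?thesis by linarith
qed

abbreviation "exp_plus \<equiv> I_exp_plus I T"
abbreviation "exp_minus \<equiv> I_exp_minus I T"
abbreviation "cheap \<equiv> I_chp I T"
abbreviation "alpha \<equiv> alpha' I T"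

lemma plus_c: "exp_plus \<subseteq> {..<c}" and minus_c: "exp_minus \<subseteq> {..<c}" and cheap_c: "cheap \<subseteq> {..<c}"
  by (auto simp: I_exp_plus_def I_exp_minus_def I_exp_def I_chp_def)

lemma finite_kinds [simp]: "finite exp_plus" "finite exp_minus" "finite cheap"
  using plus_c minus_c cheap_c by (auto intro: finite_subset)

lemma disjoint_kinds: "exp_plus \<inter> exp_minus = {}" "exp_plus \<inter> cheap = {}" "exp_minus \<inter> cheap = {}"
  using T_pos by (auto simp: I_exp_plus_def I_exp_minus_def I_exp_def I_chp_def)

text \<open>The two halves of the floor, freed of the division; later arguments use
  \<open>alpha'\<close> through these bounds.\<close>

lemma alpha_mult_le: "i < c \<Longrightarrow> real (alpha' I T i) * (T - stime I i) \<le> class_load I i"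
  and alpha_Suc_mult_gr: "i < c \<Longrightarrow> class_load I i < (real (alpha' I T i) + 1) * (T - stime I i)"
proof -
  assume "i < c"
  then have s: "0 < T - stime I i" using setup_less by simp
  define q where "q = class_load I i / (T - stime I i)"
  have q: "0 \<le> q" using s by (simp add: q_def)
  have "real (alpha' I T i) = real_of_int \<lfloor>q\<rfloor>"
    using q by (simp add: alpha'_def q_def)
  then have "real (alpha' I T i) \<le> q" "q < real (alpha' I T i) + 1" by linarith+
  then show "real (alpha' I T i) * (T - stime I i) \<le> class_load I i"
    "class_load I i < (real (alpha' I T i) + 1) * (T - stime I i)"
    using s by (auto simp: q_def field_simps)
qed

text \<open>A job has length at most \<open>T - stime I i\<close>, so a load of
  \<open>alpha'\<close> times this length takes at least \<open>alpha'\<close> jobs. Summed over the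
  classes, this makes counting up to \<open>alpha'\<close> affordable in linear time.\<close>

lemma alpha_le_card:
  assumes "i < c"
  shows "alpha' I T i \<le> card (jobs_of_class I i)"
proof -
  have "real (alpha' I T i) * (T - stime I i) \<le> (\<Sum>j\<in>jobs_of_class I i. real (proc_time I j))"
    using alpha_mult_le[OF assms] by (simp add: load_def)
  also have "\<dots> \<le> real (card (jobs_of_class I i)) * (T - stime I i)"
    by (rule sum_bounded_above) (use setup_job_le in \<open>auto simp: algebra_simps\<close>)
  finally show ?thesis using setup_less[OF assms] by simp
qed

lemma alpha_pos:
  assumes "i \<in> I_exp_plus I T"
  shows "1 \<le> alpha' I T i"
proof -
  have "i < c" "T - stime I i \<le> class_load I i"
    using assms by (auto simp: I_exp_plus_def I_exp_def)
  then show ?thesis using alpha_Suc_mult_gr[of i] by (cases "alpha' I T i") auto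
qed

end

section \<open>The wrapping passes over the three kinds of classes\<close>

definition jobs_in :: "batch_instance \<Rightarrow> nat set \<Rightarrow> nat set" where
  "jobs_in I S = {j. j < num_jobs I \<and> class_of I j \<in> S}"

lemma jobs_in_insert: "jobs_in I (insert i S) = jobs_in I S \<union> jobs_of_class I i"
  by (auto simp: jobs_in_def jobs_of_class_def)

text \<open>All class indices are visited and those outside \<open>C\<close> skipped, as in the loop
  of \<open>pass_prog\<close>, so one function serves both the correctness proof and the
  program.\<close>

definition run_pass :: "batch_instance \<Rightarrow> nat set \<Rightarrow> (nat \<Rightarrow> real) \<Rightarrow> (nat \<Rightarrow> real) \<Rightarrow>
    (nat \<times> real \<times> schedule \<Rightarrow> nat \<times> real \<times> schedule) \<Rightarrow> nat \<Rightarrow> nat \<times> real \<times> schedule \<Rightarrow>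
    nat \<times> real \<times> schedule" where
  "run_pass I C b l post k a = fold
     (\<lambda>i a. if i \<in> C then post (run_class I i (b i) (l i) (class_jobs I i) a) else a) [0..<k] a"

lemma run_pass_0 [simp]: "run_pass I C b l post 0 a = a"
  by (simp add: run_pass_def)

lemma run_pass_Suc:
  "run_pass I C b l post (Suc k) a = (let a' = run_pass I C b l post k a in
     if k \<in> C then post (run_class I k (b k) (l k) (class_jobs I k) a') else a')"
  by (simp add: run_pass_def)

fun next_machine :: "nat \<times> real \<times> schedule \<Rightarrow> nat \<times> real \<times> schedule" where
  "next_machine (u, p, \<sigma>) = (u + 1, 0, \<sigma>)"

text \<open>The threshold recognises a full pair without a counter: one class of
  \<open>I_exp_minus\<close> ends by \<open>3 / 4 * T\<close>, while two expensive setups alone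
  exceed \<open>T\<close>.\<close>

fun close_if_full :: "real \<Rightarrow> nat \<times> real \<times> schedule \<Rightarrow> nat \<times> real \<times> schedule" where
  "close_if_full T (u, p, \<sigma>) = (if 3 * T < 4 * p then (u + 1, 0, \<sigma>) else (u, p, \<sigma>))"

fun first_gap :: "real \<Rightarrow> nat \<times> real \<times> schedule \<Rightarrow> nat \<times> real \<times> schedule" where
  "first_gap T (u, p, \<sigma>) = (u, if 0 < p then T else T / 2, \<sigma>)"

definition pass_plus :: "batch_instance \<Rightarrow> real \<Rightarrow> nat \<Rightarrow> nat \<times> real \<times> schedule" where
  "pass_plus I T k = run_pass I (I_exp_plus I T) (stime I)
     (\<lambda>i. stime I i + class_load I i / real (alpha' I T i)) next_machine k (0, 0, [])"

definition pass_minus :: "batch_instance \<Rightarrow> real \<Rightarrow> nat \<Rightarrow> nat \<times> real \<times> schedule" where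
  "pass_minus I T k = run_pass I (I_exp_minus I T) (stime I) (\<lambda>i. 3 * T / 2)
     (close_if_full T) k (pass_plus I T (num_classes I))"

definition pass_cheap :: "batch_instance \<Rightarrow> real \<Rightarrow> nat \<Rightarrow> nat \<times> real \<times> schedule" where
  "pass_cheap I T k = run_pass I (I_chp I T) (\<lambda>i. T / 2) (\<lambda>i. 3 * T / 2)
     id k (first_gap T (pass_minus I T (num_classes I)))"

lemma partial_schedule_mono:
  assumes "partial_schedule I B D (u, p, \<sigma>)" "u < u' \<or> u = u' \<and> p \<le> p'" "0 \<le> p'"
  shows "partial_schedule I B D (u', p', \<sigma>)"
  using assms by (fastforce simp: partial_schedule_def)

locale feasible_bound = bounded_instance +
  assumes nice: "nice I T" and L_le: "real (L_nice I T) \<le> real (num_machines I) * T"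
    and m_le: "m_nice I T \<le> num_machines I"
begin

text \<open>Niceness enters here: it makes the three kinds cover all classes, so that the passes
  schedule every job.\<close>

lemma all_kinds: "exp_plus \<union> exp_minus \<union> cheap = {..<c}"
proof -
  have "i \<in> exp_plus \<union> exp_minus \<union> cheap" if "i < c" for i
  proof -
    have "i \<notin> I_exp_zero I T" using nice by (simp add: nice_def)
    then show ?thesis using that
      unfolding I_exp_plus_def I_exp_minus_def I_exp_def I_chp_def I_exp_zero_def by fastforce
  qed
  then show ?thesis using plus_c minus_c cheap_c by blast
qed

lemma run_class_partial':
  fixes b l :: real
  assumes "partial_schedule I B (jobs_in I S) (u, p, \<sigma>)" "i < c" "i \<notin> S"
    and "\<And>j. j \<in> jobs_of_class I i \<Longrightarrow> b + real (proc_time I j) \<le> l"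
    and "stime I i \<le> b" "b < l" "l \<le> B" "b \<le> p + stime I i"
    and "real u * (l - b) + p + stime I i + class_load I i \<le> real M * (l - b) + b"
    and "M \<le> m"
    and "run_class I i b l (class_jobs I i) (u, p, \<sigma>) = (u', p', \<sigma>')"
  shows "partial_schedule I B (jobs_in I (insert i S)) (u', p', \<sigma>')" "b < p'" "p' \<le> l" "u \<le> u'"
    "real u' * (l - b) + p' \<le> real u * (l - b) + p + stime I i + class_load I i"
    "u' = u \<Longrightarrow> p + stime I i < p'" "u' < M"
proof -
  have "set (class_jobs I i) \<noteq> {}"
    using class_jobs_ne[OF assms(2)] by (simp only: set_class_jobs not_False_eq_True)
  then have ne: "class_jobs I i \<noteq> []" by auto
  have A: "set (class_jobs I i) \<inter> jobs_in I S = {}"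
    unfolding set_class_jobs using assms(3) by (auto simp: jobs_in_def jobs_of_class_def)
  have B: "\<And>j. j \<in> set (class_jobs I i) \<Longrightarrow> j < n \<and> class_of I j = i \<and> 0 < proc_time I j \<and>
      b + real (proc_time I j) \<le> l"
    using assms(4) job_pos by (auto simp: set_class_jobs jobs_of_class_def)
  note * = run_class_partial[OF assms(1) distinct_class_jobs A assms(2) ne B assms(5-8) _
      assms(10,11), unfolded sum_class_jobs set_class_jobs, OF _ assms(9)]
  show "partial_schedule I B (jobs_in I (insert i S)) (u', p', \<sigma>')" "b < p'" "p' \<le> l" "u \<le> u'"
    "real u' * (l - b) + p' \<le> real u * (l - b) + p + stime I i + class_load I i"
    "u' = u \<Longrightarrow> p + stime I i < p'" "u' < M"
    unfolding jobs_in_insert using * by auto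
qed

lemma Int_lessThan_Suc: "k \<in> A \<Longrightarrow> A \<inter> {..<Suc k} = insert k (A \<inter> {..<k})"
  "k \<notin> A \<Longrightarrow> A \<inter> {..<Suc k} = A \<inter> {..<k}"
  by (auto simp: less_Suc_eq)

text \<open>Doubling removes the ceiling of \<open>m_nice\<close>; a class of
  \<open>I_exp_minus\<close> counts as half a machine.\<close>

lemma two_machines_le: "2 * (\<Sum>i\<in>exp_plus. alpha i) + card exp_minus \<le> 2 * m"
proof -
  have "real (card exp_minus) / 2 \<le> real (nat \<lceil>real (card exp_minus) / 2\<rceil>)" by linarith
  then show ?thesis using m_le unfolding m_nice_def by linarith
qed

text \<open>By the two bounds on \<open>alpha'\<close>, the gap length \<open>g\<close> satisfies
  \<open>T - s \<le> g < 2 * (T - s)\<close>. The lower bound lets every job fit into a gap;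
  together with \<open>s > T / 2\<close> the upper one gives \<open>s + g < 3 / 2 * T\<close>. The
  class uses at most \<open>alpha'\<close> machines, and the next class starts on a fresh
  one.\<close>

lemma pass_plus_partial:
  assumes "k \<le> c" "pass_plus I T k = (u, p, \<sigma>)"
  shows "partial_schedule I (3 * T / 2) (jobs_in I (exp_plus \<inter> {..<k})) (u, p, \<sigma>) \<and> p = 0 \<and>
    u \<le> (\<Sum>i\<in>exp_plus \<inter> {..<k}. alpha i)"
  using assms
proof (induction k arbitrary: u p \<sigma>)
  case 0
  then show ?case
    by (auto simp: pass_plus_def partial_schedule_def jobs_in_def valid_def on_machine_def
        setups_respected_def job_time_def)
next
  case (Suc k)
  obtain u0 p0 \<sigma>0 where a: "pass_plus I T k = (u0, p0, \<sigma>0)" by (metis prod_cases3)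
  have IH: "partial_schedule I (3 * T / 2) (jobs_in I (exp_plus \<inter> {..<k})) (u0, p0, \<sigma>0)" "p0 = 0"
    "u0 \<le> (\<Sum>i\<in>exp_plus \<inter> {..<k}. alpha i)"
    using Suc.IH[OF Suc_leD[OF Suc.prems(1)] a] by blast+
  show ?case
  proof (cases "k \<in> exp_plus")
    case False
    then show ?thesis using Suc.prems(2) a IH
      by (simp add: pass_plus_def run_pass_Suc Int_lessThan_Suc)
  next
    case True
    define s g b l where "s = stime I k" and "g = class_load I k / real (alpha k)"
      and "b = s" and "l = s + g"
    have kc: "k < c" and exp: "T < 2 * s" and big: "T \<le> s + class_load I k"
      using True plus_c by (auto simp: I_exp_plus_def I_exp_def s_def)
    have al: "1 \<le> alpha k" using alpha_pos[OF True] .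
    have gP: "real (alpha k) * g = class_load I k" using al by (simp add: g_def)
    have sT: "s < T" using setup_less[OF kc] by (simp add: s_def)
    have g1: "T - s \<le> g"
      using alpha_mult_le[OF kc] al by (simp add: g_def s_def field_simps)
    have g2: "g < 2 * (T - s)"
    proof -
      have "real (alpha k) * g < (real (alpha k) + 1) * (T - s)"
        using alpha_Suc_mult_gr[OF kc] gP by (simp add: s_def)
      \<comment> \<open>This is \<open>alpha k + 1 \<le> 2 * alpha k\<close>, from
        \<open>1 \<le> alpha k\<close>.\<close>
      also have "\<dots> \<le> real (alpha k) * (2 * (T - s))"
      proof -
        have "1 * (T - s) \<le> real (alpha k) * (T - s)"
          using al sT by (intro mult_right_mono) auto
        then show ?thesis by (simp add: algebra_simps)
      qed
      finally show ?thesis using al by simp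
    qed
    have sub: "sum alpha (exp_plus \<inter> {..<Suc k}) = sum alpha (exp_plus \<inter> {..<k}) + alpha k"
      using True by (simp add: Int_lessThan_Suc)
    have "sum alpha (exp_plus \<inter> {..<Suc k}) \<le> sum alpha exp_plus"
      by (rule sum_mono2) auto
    then have M: "u0 + alpha k \<le> m" using IH(3) sub two_machines_le by linarith
    obtain u1 p1 \<sigma>1 where r: "run_class I k b l (class_jobs I k) (u0, p0, \<sigma>0) = (u1, p1, \<sigma>1)"
      by (metis prod_cases3)
    have fin: "u = u1 + 1" "p = 0" "\<sigma> = \<sigma>1"
      using Suc.prems(2) a True r
      by (simp_all add: pass_plus_def run_pass_Suc s_def b_def l_def g_def)
    have pre: "k \<notin> exp_plus \<inter> {..<k}"
      "\<And>j. j \<in> jobs_of_class I k \<Longrightarrow> b + real (proc_time I j) \<le> l"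
      "stime I k \<le> b" "b < l" "l \<le> 3 * T / 2" "b \<le> p0 + stime I k"
      using setup_job_le[of _ k] IH(2) g1 g2 sT exp by (fastforce simp: b_def l_def s_def)+
    \<comment> \<open>Both sides are equal, as \<open>alpha k\<close> gaps of length
      \<open>g\<close> hold exactly the load of the class.\<close>
    have "real u0 * (l - b) + p0 + stime I k + class_load I k \<le> real (u0 + alpha k) * (l - b) + b"
      using gP IH(2) by (simp add: b_def l_def s_def algebra_simps)
    note main = run_class_partial'(1,7)[OF IH(1) kc pre this M r]
    then show ?thesis
      using fin True IH(3) sub partial_schedule_mono[OF main(1), of u p]
      by (simp add: Int_lessThan_Suc)
  qed
qed

text \<open>Machines are counted in halves: a completed one counts 2, one with a single class 1. As
  setup and load of a class take at most \<open>3 / 4 * T\<close>, a pair ends by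
  \<open>3 / 2 * T\<close> and no job is cut.\<close>

lemma pass_minus_partial:
  assumes "k \<le> c" "pass_minus I T k = (u, p, \<sigma>)"
  shows "partial_schedule I (3 * T / 2) (jobs_in I (exp_plus \<union> exp_minus \<inter> {..<k})) (u, p, \<sigma>) \<and>
    (p = 0 \<or> T / 2 < p \<and> p \<le> 3 * T / 4) \<and>
    2 * u + (if p = 0 then 0 else 1) \<le> 2 * sum alpha exp_plus + card (exp_minus \<inter> {..<k})"
  using assms
proof (induction k arbitrary: u p \<sigma>)
  case 0
  have "exp_plus \<inter> {..<c} = exp_plus" using plus_c by auto
  moreover have a: "pass_plus I T c = (u, p, \<sigma>)" using 0 by (simp add: pass_minus_def)
  ultimately show ?case using pass_plus_partial[OF order_refl a] by auto
next
  case (Suc k)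
  obtain u0 p0 \<sigma>0 where a: "pass_minus I T k = (u0, p0, \<sigma>0)" by (metis prod_cases3)
  have IH: "partial_schedule I (3 * T / 2) (jobs_in I (exp_plus \<union> exp_minus \<inter> {..<k})) (u0, p0, \<sigma>0)"
    "p0 = 0 \<or> T / 2 < p0 \<and> p0 \<le> 3 * T / 4"
    "2 * u0 + (if p0 = 0 then 0 else 1) \<le> 2 * sum alpha exp_plus + card (exp_minus \<inter> {..<k})"
    using Suc.IH[OF _ a] Suc.prems(1) by simp_all
  show ?case
  proof (cases "k \<in> exp_minus")
    case False
    then show ?thesis using Suc.prems(2) a IH
      by (simp add: pass_minus_def run_pass_Suc Int_lessThan_Suc)
  next
    case True
    define s b l where "s = stime I k" and "b = s" and "l = 3 * T / 2"
    have kc: "k < c" and exp: "T < 2 * s" and small: "s + class_load I k \<le> 3 / 4 * T"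
      using True minus_c by (auto simp: I_exp_minus_def I_exp_def s_def)
    have cS: "card (exp_minus \<inter> {..<Suc k}) = card (exp_minus \<inter> {..<k}) + 1"
      using True by (simp add: Int_lessThan_Suc)
    have "card (exp_minus \<inter> {..<Suc k}) \<le> card exp_minus"
      by (rule card_mono) auto
    then have M: "u0 + 1 \<le> m" using IH(3) cS two_machines_le by linarith
    have sT: "s < T" using setup_less[OF kc] by (simp add: s_def)
    have p0: "0 \<le> p0" "p0 \<le> 3 * T / 4" using IH(2) T_pos by auto
    obtain u1 p1 \<sigma>1 where r: "run_class I k b l (class_jobs I k) (u0, p0, \<sigma>0) = (u1, p1, \<sigma>1)"
      by (metis prod_cases3)
    have fin: "(u, p, \<sigma>) = close_if_full T (u1, p1, \<sigma>1)"
      using Suc.prems(2) a True r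
      by (simp add: pass_minus_def run_pass_Suc s_def b_def l_def)
    have pre: "k \<notin> exp_plus \<union> exp_minus \<inter> {..<k}"
      using True disjoint_kinds by auto
    have pre': "\<And>j. j \<in> jobs_of_class I k \<Longrightarrow> b + real (proc_time I j) \<le> l"
      "stime I k \<le> b" "b < l" "l \<le> 3 * T / 2" "b \<le> p0 + stime I k"
      using setup_job_le[of _ k] p0 sT exp by (fastforce simp: b_def l_def s_def)+
    have "real u0 * (l - b) + p0 + stime I k + class_load I k \<le> real (u0 + 1) * (l - b) + b"
      using p0 small by (simp add: b_def l_def s_def algebra_simps)
    note main = run_class_partial'(1,2,4,5,6,7)[OF IH(1) kc pre pre' this M r, folded s_def]
    \<comment> \<open>The budget \<open>u0 + 1\<close> forbids a change of machine.\<close>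
    have u1: "u1 = u0" using main(3,6) by simp
    have p1: "p1 \<le> p0 + s + class_load I k" "p0 + s < p1" "T / 2 < p1"
      using main(2,4,5) u1 exp b_def by auto
    have D: "insert k (exp_plus \<union> exp_minus \<inter> {..<k}) = exp_plus \<union> exp_minus \<inter> {..<Suc k}"
      using True by (auto simp: less_Suc_eq)
    show ?thesis
    \<comment> \<open>A machine found full carried a class before \<open>k\<close>; one found not
      full was empty.\<close>
    proof (cases "3 * T < 4 * p1")
      case True
      then have r: "u = u0 + 1" "p = 0" "\<sigma> = \<sigma>1" using fin u1 by auto
      have "p0 \<noteq> 0" using True p1 small by auto
      then show ?thesis
        using r IH(3) cS u1 D partial_schedule_mono[OF main(1), of u p] by simp
    next
      case False
      then have r: "u = u0" "p = p1" "\<sigma> = \<sigma>1" using fin u1 by auto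
      have "p0 = 0"
        using IH(2) False p1 exp by auto
      then show ?thesis
        using r IH(3) cS u1 D main(1) p1 False T_pos by simp
    qed
  qed
qed

lemma sum_kinds: "(\<Sum>i<c. f i) = sum f exp_plus + sum f exp_minus + sum f cheap"
  using disjoint_kinds
  by (simp add: all_kinds[symmetric] sum.union_disjoint Int_Un_distrib2)

text \<open>A volume argument. Classes of \<open>I_exp_plus\<close> bring at least \<open>T\<close>
  for each of their \<open>alpha'\<close> machines, since \<open>alpha' * (T - s)\<close> is at most
  the class load, and those of \<open>I_exp_minus\<close> at least \<open>T / 2\<close> each. So the
  initial potential is at most the expensive share of \<open>L_nice\<close> plus
  \<open>T / 2\<close>, and \<open>L_nice \<le> m * T\<close> leaves the rest to the cheap classes.
  The \<open>T / 2\<close> on the right is the base of the gaps.\<close>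

lemma room_for_cheap:
  assumes "first_gap T (pass_minus I T c) = (u, p, \<sigma>)"
  shows "real u * T + p + (\<Sum>i\<in>cheap. stime I i + class_load I i) \<le> real m * T + T / 2"
proof -
  obtain p0 where a: "pass_minus I T c = (u, p0, \<sigma>)" and p: "p = (if 0 < p0 then T else T / 2)"
    using assms by (cases "pass_minus I T c") auto
  have mc: "exp_minus \<inter> {..<c} = exp_minus" using minus_c by auto
  have P: "p0 = 0 \<or> T / 2 < p0"
    "2 * u + (if p0 = 0 then 0 else 1) \<le> 2 * sum alpha exp_plus + card exp_minus"
    using pass_minus_partial[OF order_refl a] mc by auto
  have "real (2 * u + (if p0 = 0 then 0 else 1)) \<le> real (2 * sum alpha exp_plus + card exp_minus)"
    using P(2) of_nat_le_iff by blast
  then have "2 * real u + (if p0 = 0 then 0 else 1) \<le> 2 * real (sum alpha exp_plus) + real (card exp_minus)"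
    by (simp split: if_splits)
  \<comment> \<open>Each half machine is worth \<open>T / 2\<close>; an unpaired class is what makes
    \<open>p\<close> equal to \<open>T\<close> instead of \<open>T / 2\<close>.\<close>
  then have "T / 2 * (2 * real u + (if p0 = 0 then 0 else 1)) \<le>
      T / 2 * (2 * real (sum alpha exp_plus) + real (card exp_minus))"
    using T_pos by (intro mult_left_mono) auto
  then have *: "real u * T + p \<le> T / 2 + (real (sum alpha exp_plus) * T + real (card exp_minus) * (T / 2))"
    using P(1) T_pos by (auto simp: p algebra_simps)
  have exp_plus': "real (sum alpha exp_plus) * T \<le>
      (\<Sum>i\<in>exp_plus. class_load I i + real (alpha i) * stime I i)"
    unfolding of_nat_sum sum_distrib_right
    using alpha_mult_le plus_c by (intro sum_mono) (auto simp: algebra_simps)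
  have "real (card exp_minus) * (T / 2) = (\<Sum>i\<in>exp_minus. T / 2)" by simp
  also have "\<dots> \<le> (\<Sum>i\<in>exp_minus. class_load I i + stime I i)"
    by (intro sum_mono) (auto simp: I_exp_minus_def I_exp_def)
  finally have exp_minus': "real (card exp_minus) * (T / 2) \<le> \<dots>" .
  have "real (L_nice I T) = (\<Sum>i<c. class_load I i) + (\<Sum>i\<in>exp_plus. real (alpha i) * stime I i)
      + (\<Sum>i\<in>exp_minus. stime I i) + (\<Sum>i\<in>cheap. stime I i)"
    using disjoint_kinds(3) by (simp add: L_nice_def load_by_class[OF wf] sum.union_disjoint)
  then show ?thesis using * exp_plus' exp_minus' L_le
    by (simp add: sum_kinds sum.distrib)
qed

text \<open>All cheap classes share the gap from \<open>T / 2\<close> to \<open>3 / 2 * T\<close>,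
  of length \<open>T\<close>, so the potential accumulates across classes. A cheap setup takes at
  most \<open>T / 2\<close> and therefore fits below the gap.\<close>

lemma pass_cheap_partial:
  assumes "k \<le> c" "pass_cheap I T k = (u, p, \<sigma>)"
    and start: "first_gap T (pass_minus I T c) = (u\<^sub>0, p\<^sub>0, \<sigma>\<^sub>0)"
  shows "partial_schedule I (3 * T / 2) (jobs_in I (exp_plus \<union> exp_minus \<union> cheap \<inter> {..<k})) (u, p, \<sigma>) \<and>
    T / 2 \<le> p \<and> real u * T + p \<le>
      real u\<^sub>0 * T + p\<^sub>0 + (\<Sum>i\<in>cheap \<inter> {..<k}. stime I i + class_load I i)"
  using assms(1,2)
proof (induction k arbitrary: u p \<sigma>)
  case 0
  obtain p1 where a: "pass_minus I T c = (u\<^sub>0, p1, \<sigma>\<^sub>0)" and p: "p\<^sub>0 = (if 0 < p1 then T else T / 2)"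
    using start by (cases "pass_minus I T c") auto
  have mc: "exp_minus \<inter> {..<c} = exp_minus" using minus_c by auto
  have P: "partial_schedule I (3 * T / 2) (jobs_in I (exp_plus \<union> exp_minus)) (u\<^sub>0, p1, \<sigma>\<^sub>0)"
    "p1 = 0 \<or> T / 2 < p1 \<and> p1 \<le> 3 * T / 4"
    using pass_minus_partial[OF order_refl a] mc by auto
  have "partial_schedule I (3 * T / 2) (jobs_in I (exp_plus \<union> exp_minus)) (u\<^sub>0, p\<^sub>0, \<sigma>\<^sub>0)"
    by (rule partial_schedule_mono[OF P(1)]) (use P(2) T_pos p in auto)
  moreover have "T / 2 \<le> p\<^sub>0" using T_pos p by simp
  ultimately show ?case using 0 by (simp add: pass_cheap_def start)
next
  case (Suc k)
  obtain u0 p0 \<sigma>0 where a: "pass_cheap I T k = (u0, p0, \<sigma>0)" by (metis prod_cases3)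
  have IH: "partial_schedule I (3 * T / 2) (jobs_in I (exp_plus \<union> exp_minus \<union> cheap \<inter> {..<k})) (u0, p0, \<sigma>0)"
    "T / 2 \<le> p0" "real u0 * T + p0 \<le>
      real u\<^sub>0 * T + p\<^sub>0 + (\<Sum>i\<in>cheap \<inter> {..<k}. stime I i + class_load I i)"
    using Suc.IH[OF _ a] Suc.prems(1) by simp_all
  show ?case
  proof (cases "k \<in> cheap")
    case False
    then show ?thesis using Suc.prems(2) a IH
      by (simp add: pass_cheap_def run_pass_Suc Int_lessThan_Suc)
  next
    case True
    define b l where "b = T / 2" and "l = 3 * T / 2"
    have kc: "k < c" and chp: "2 * stime I k \<le> T"
      using True cheap_c by (auto simp: I_chp_def)
    have g: "l - b = T" by (simp add: b_def l_def)
    have sub: "(\<Sum>i\<in>cheap \<inter> {..<Suc k}. stime I i + class_load I i) =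
        (\<Sum>i\<in>cheap \<inter> {..<k}. stime I i + class_load I i) + (stime I k + class_load I k)"
      using True by (simp add: Int_lessThan_Suc)
    have "(\<Sum>i\<in>cheap \<inter> {..<Suc k}. stime I i + class_load I i) \<le>
        (\<Sum>i\<in>cheap. stime I i + class_load I i)"
      by (rule sum_mono2) auto
    then have bound: "real u0 * T + p0 + stime I k + class_load I k \<le> real m * T + T / 2"
      using IH(3) sub room_for_cheap[OF start] by linarith
    obtain u1 p1 \<sigma>1 where r: "run_class I k b l (class_jobs I k) (u0, p0, \<sigma>0) = (u1, p1, \<sigma>1)"
      by (metis prod_cases3)
    have fin: "u = u1" "p = p1" "\<sigma> = \<sigma>1"
      using Suc.prems(2) a True r
      by (simp_all add: pass_cheap_def run_pass_Suc b_def l_def)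
    have pre: "k \<notin> exp_plus \<union> exp_minus \<union> cheap \<inter> {..<k}"
      using True disjoint_kinds by auto
    have pre': "b + real (proc_time I j) \<le> l" if "j \<in> jobs_of_class I k" for j
      using setup_job_le[OF that] by (simp add: b_def l_def)
    have pre'': "stime I k \<le> b" "b < l" "l \<le> 3 * T / 2" "b \<le> p0 + stime I k"
      using chp IH(2) T_pos by (auto simp: b_def l_def)
    have bound': "real u0 * (l - b) + p0 + stime I k + class_load I k \<le> real m * (l - b) + b"
      using bound unfolding g by (simp add: b_def)
    note main = run_class_partial'(1,2,5)[OF IH(1) kc pre pre' pre'' bound' order_refl r]
    moreover have "insert k (exp_plus \<union> exp_minus \<union> cheap \<inter> {..<k}) = exp_plus \<union> exp_minus \<union> cheap \<inter> {..<Suc k}"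
      using True by (auto simp: less_Suc_eq)
    ultimately show ?thesis using main IH(3) sub fin g b_def by simp
  qed
qed

theorem pass_cheap_correct:
  assumes "pass_cheap I T c = (u, p, \<sigma>)"
  shows "pmtn_feasible I \<sigma> \<and> makespan \<sigma> \<le> 3 / 2 * T"
proof -
  have "cheap \<inter> {..<c} = cheap" using cheap_c by auto
  then have ps: "partial_schedule I (3 * T / 2) (jobs_in I {..<c}) (u, p, \<sigma>)"
    using pass_cheap_partial[OF order_refl assms] all_kinds by (metis prod_cases3)
  have "pmtn_feasible I \<sigma>"
    by (rule valid_feasible) (use ps job_class in \<open>auto simp: partial_schedule_def jobs_in_def\<close>)
  moreover have "makespan \<sigma> \<le> 3 / 2 * T"
    unfolding makespan_def by (rule Max.boundedI) (use ps T_pos in \<open>auto simp: partial_schedule_def\<close>)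
  ultimately show ?thesis by simp
qed

end

section \<open>Running programs\<close>

text \<open>Total correctness with an upper bound on the steps, which permits crude estimates:
  \<open>cost\<close> charges both branches of a conditional.\<close>

definition reaches :: "com \<Rightarrow> ram_state \<Rightarrow> nat \<Rightarrow> (ram_state \<Rightarrow> bool) \<Rightarrow> bool" where
  "reaches c s k Q \<longleftrightarrow> (\<exists>l s'. exec c s l s' \<and> l \<le> k \<and> Q s')"

primrec loop_free :: "com \<Rightarrow> bool" where
  "loop_free Skip = True"
| "loop_free (NSet x a e) = True"
| "loop_free (RSet x a e) = True"
| "loop_free (Seq c d) = (loop_free c \<and> loop_free d)"
| "loop_free (Cond b c d) = (loop_free c \<and> loop_free d)"
| "loop_free (While b c) = False"

text \<open>The values of \<open>run\<close> and \<open>cost\<close> on loops are junk.\<close>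

primrec run :: "com \<Rightarrow> ram_state \<Rightarrow> ram_state" where
  "run Skip s = s"
| "run (NSet x a e) s = nat_update x (neval a s) (neval e s) s"
| "run (RSet x a e) s = real_update x (neval a s) (reval e s) s"
| "run (Seq c d) s = run d (run c s)"
| "run (Cond b c d) s = (if beval b s then run c s else run d s)"
| "run (While b c) s = s"

primrec cost :: "com \<Rightarrow> nat" where
  "cost Skip = 1"
| "cost (NSet x a e) = 1 + ncost a + ncost e"
| "cost (RSet x a e) = 1 + ncost a + rcost e"
| "cost (Seq c d) = 1 + cost c + cost d"
| "cost (Cond b c d) = 1 + bcost b + cost c + cost d"
| "cost (While b c) = 1"

lemma reaches_mono:
  "reaches c s k Q \<Longrightarrow> k \<le> k' \<Longrightarrow> (\<And>s'. Q s' \<Longrightarrow> Q' s') \<Longrightarrow> reaches c s k' Q'"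
  unfolding reaches_def by (meson le_trans)

lemma reaches_Seq:
  "reaches c s k (\<lambda>s'. reaches d s' l Q) \<Longrightarrow> reaches (Seq c d) s (1 + k + l) Q"
  unfolding reaches_def by (fastforce intro: exec.Seq)

lemma reaches_Cond:
  "(beval b s \<Longrightarrow> reaches c s k Q) \<Longrightarrow> (\<not> beval b s \<Longrightarrow> reaches d s k Q) \<Longrightarrow>
    reaches (Cond b c d) s (1 + bcost b + k) Q"
  unfolding reaches_def
  by (cases "beval b s") (fastforce intro: exec.CondTrue exec.CondFalse)+

text \<open>Executing loop-free code is reduced to evaluating the function \<open>run\<close>, which
  the simplifier can do symbolically.\<close>

lemma reaches_run:
  assumes "loop_free c" "Q (run c s)"
  shows "reaches c s (cost c) Q"
proof -
  have "loop_free c \<Longrightarrow> reaches c s (cost c) (\<lambda>s'. s' = run c s)" for c s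
  proof (induction c arbitrary: s)
    case (Seq c d)
    have "reaches c s (cost c) (\<lambda>s'. reaches d s' (cost d) (\<lambda>s''. s'' = run (Seq c d) s))"
      using Seq by (auto intro: reaches_mono)
    from reaches_Seq[OF this] show ?case by simp
  next
    case (Cond b c d)
    have "reaches (Cond b c d) s (1 + bcost b + (cost c + cost d)) (\<lambda>s'. s' = run (Cond b c d) s)"
      by (rule reaches_Cond; rule reaches_mono[OF Cond.IH(1)] reaches_mono[OF Cond.IH(2)])
        (use Cond.prems in auto)
    then show ?case by (simp add: add.assoc)
  qed (fastforce simp: reaches_def intro: exec.intros)+
  with assms show ?thesis by (auto intro: reaches_mono)
qed

lemma reaches_run_Seq:
  "loop_free c \<Longrightarrow> reaches d (run c s) l Q \<Longrightarrow> reaches (Seq c d) s (1 + cost c + l) Q"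
  by (rule reaches_Seq) (rule reaches_run)

text \<open>The loop simulates \<open>fold f xs\<close>, with the elements still to come as a ghost
  argument of \<open>Inv\<close>. The bound \<open>k x\<close> depends on the element, so classes of
  different sizes are charged separately.\<close>

lemma reaches_While_list:
  assumes step: "\<And>x xs a s. Inv (x # xs) a s \<Longrightarrow>
      beval b s \<and> reaches body s (k x) (Inv xs (f x a))"
    and stop: "\<And>a s. Inv [] a s \<Longrightarrow> \<not> beval b s"
    and "Inv xs a s"
  shows "reaches (While b body) s ((\<Sum>x\<leftarrow>xs. 1 + bcost b + k x) + 1 + bcost b)
    (Inv [] (fold f xs a))"
  using assms(3)
proof (induction xs arbitrary: a s)
  case Nil
  then show ?case using stop[OF Nil]
    by (auto simp: reaches_def intro!: exI exec.WhileFalse)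
next
  case (Cons x xs)
  from step[OF Cons.prems] obtain l s' where b: "beval b s"
    and e: "exec body s l s'" "l \<le> k x" "Inv xs (f x a) s'"
    by (auto simp: reaches_def)
  from Cons.IH[OF e(3)] obtain l' s'' where
    "exec (While b body) s' l' s''" "l' \<le> (\<Sum>x\<leftarrow>xs. 1 + bcost b + k x) + 1 + bcost b"
    "Inv [] (fold f xs (f x a)) s''"
    by (auto simp: reaches_def)
  then show ?case using exec.WhileTrue[OF b e(1)] e(2)
    unfolding reaches_def by (fastforce intro!: exI)
qed

text \<open>For loops counted by a decreasing measure rather than by a list. At measure 0 the test
  must fail, as nothing could decrease.\<close>

lemma reaches_While_measure:
  assumes step: "\<And>s. Inv s \<Longrightarrow> beval b s \<Longrightarrow>
      reaches body s k (\<lambda>s'. Inv s' \<and> \<mu> s' < (\<mu> s :: nat))"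
    and "Inv s" "\<mu> s \<le> N"
  shows "reaches (While b body) s ((1 + bcost b + k) * N + 1 + bcost b)
    (\<lambda>s'. Inv s' \<and> \<not> beval b s')"
  using assms(2,3)
proof (induction N arbitrary: s)
  case 0
  then have "\<not> beval b s" using step[of s] by (auto simp: reaches_def)
  then show ?case using 0
    by (auto simp: reaches_def intro!: exI exec.WhileFalse)
next
  case (Suc N)
  show ?case
  proof (cases "beval b s")
    case False
    then show ?thesis using Suc.prems
      by (auto simp: reaches_def intro!: exI exec.WhileFalse)
  next
    case True
    from step[OF Suc.prems(1) True] obtain l s' where e: "exec body s l s'" "l \<le> k"
      "Inv s'" "\<mu> s' < \<mu> s" by (auto simp: reaches_def)
    from Suc.IH[OF e(3)] e(4) Suc.prems(2) obtain l' s'' where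
      "exec (While b body) s' l' s''" "l' \<le> (1 + bcost b + k) * N + 1 + bcost b"
      "Inv s'' \<and> \<not> beval b s''"
      by (auto simp: reaches_def)
    then show ?thesis using exec.WhileTrue[OF True e(1)] e(2)
      unfolding reaches_def by (fastforce intro!: exI)
  qed
qed

section \<open>Memory updates, output entries and data layout\<close>

lemma nats_nat_update [simp]:
  "nats (nat_update x k v s) y = (if y = x then (nats s x)(k := v) else nats s y)"
  and reals_nat_update [simp]: "reals (nat_update x k v s) = reals s"
  and nats_real_update [simp]: "nats (real_update x k r s) = nats s"
  and reals_real_update [simp]:
  "reals (real_update x k r s) y = (if y = x then (reals s x)(k := r) else reals s y)"
  by (simp_all add: nat_update_def real_update_def)

abbreviation nvar :: "string \<Rightarrow> nexp" where
  "nvar x \<equiv> NGet x (NConst 0)"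

abbreviation rvar :: "string \<Rightarrow> rexp" where
  "rvar x \<equiv> RGet x (NConst 0)"

text \<open>The counter \<open>entries\<close> is advanced last, so that all five arrays are written
  at the same index.\<close>

definition emit :: "nat \<Rightarrow> nexp \<Rightarrow> rexp \<Rightarrow> rexp \<Rightarrow> com" where
  "emit k ie ae de =
     Seq (NSet ''machine'' (nvar ''entries'') (nvar ''u''))
    (Seq (NSet ''kind'' (nvar ''entries'') (NConst k))
    (Seq (NSet ''id'' (nvar ''entries'') ie)
    (Seq (RSet ''start'' (nvar ''entries'') ae)
    (Seq (RSet ''duration'' (nvar ''entries'') de)
         (NSet ''entries'' (NConst 0) (NAdd (nvar ''entries'') (NConst 1)))))))"

definition add_entry :: "nat \<Rightarrow> nat \<Rightarrow> real \<Rightarrow> real \<Rightarrow> ram_state \<Rightarrow> ram_state" where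
  "add_entry k i a d s = (let e = nats s ''entries'' 0 in
     nat_update ''entries'' 0 (e + 1) (real_update ''duration'' e d (real_update ''start'' e a
       (nat_update ''id'' e i (nat_update ''kind'' e k
         (nat_update ''machine'' e (nats s ''u'' 0) s))))))"

text \<open>Expressions not reading the output arrays, hence unaffected by the earlier assignments of \<open>emit\<close>.\<close>

primrec nsafe :: "nexp \<Rightarrow> bool" where
  "nsafe (NConst k) = True"
| "nsafe (NGet x a) = (x \<notin> {''machine'', ''kind'', ''id''} \<and> nsafe a)"
| "nsafe (NAdd a b) = (nsafe a \<and> nsafe b)"
| "nsafe (NSub a b) = (nsafe a \<and> nsafe b)"

primrec rsafe :: "rexp \<Rightarrow> bool" where
  "rsafe (OfNat a) = nsafe a"
| "rsafe (RGet x a) = (x \<notin> {''start'', ''duration''} \<and> nsafe a)"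
| "rsafe (RAdd a b) = (rsafe a \<and> rsafe b)"
| "rsafe (RSub a b) = (rsafe a \<and> rsafe b)"
| "rsafe (RMul a b) = (rsafe a \<and> rsafe b)"
| "rsafe (RDiv a b) = (rsafe a \<and> rsafe b)"

lemma neval_safe:
  assumes "nsafe e"
  shows "x \<in> {''machine'', ''kind'', ''id''} \<Longrightarrow> neval e (nat_update x k v s) = neval e s"
    and "neval e (real_update y k r s) = neval e s"
  using assms by (induction e) auto

lemma reval_safe:
  assumes "rsafe e"
  shows "x \<in> {''machine'', ''kind'', ''id''} \<Longrightarrow> reval e (nat_update x k v s) = reval e s"
    and "y \<in> {''start'', ''duration''} \<Longrightarrow> reval e (real_update y k r s) = reval e s"
  using assms by (induction e) (auto simp: neval_safe)

lemma run_emit [simp]: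
  assumes "nsafe ie" "rsafe ae" "rsafe de"
  shows "run (emit k ie ae de) s = add_entry k (neval ie s) (reval ae s) (reval de s) s"
  using assms by (simp add: emit_def add_entry_def Let_def neval_safe reval_safe)

lemma loop_free_emit [simp]: "loop_free (emit k ie ae de)"
  by (simp add: emit_def)

lemma add_entry_nats [simp]:
  "x \<notin> {''entries'', ''machine'', ''kind'', ''id''} \<Longrightarrow> nats (add_entry k i a d s) x = nats s x"
  and add_entry_reals [simp]:
  "x \<notin> {''start'', ''duration''} \<Longrightarrow> reals (add_entry k i a d s) x = reals s x"
  by (auto simp: add_entry_def Let_def)

lemma output_schedule_add_entry [simp]:
  "output_schedule (add_entry k i a d s) =
     output_schedule s @ [Entry (nats s ''u'' 0) a d (if k = 0 then Setup i else Piece i)]"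
  by (auto simp: output_schedule_def add_entry_def Let_def)

lemma output_schedule_update [simp]:
  "x \<notin> {''entries'', ''machine'', ''kind'', ''id''} \<Longrightarrow>
    output_schedule (nat_update x k v s) = output_schedule s"
  "x \<notin> {''start'', ''duration''} \<Longrightarrow>
    output_schedule (real_update x k r s) = output_schedule s"
  by (auto simp: output_schedule_def)

text \<open>Lists of jobs are stored as linked lists, with \<open>j + 1\<close> for a reference to job \<open>j\<close> and 0 at the end.\<close>

fun link :: "nat list \<Rightarrow> nat" where
  "link [] = 0"
| "link (j # js) = j + 1"

fun linked :: "(nat \<Rightarrow> nat) \<Rightarrow> nat list \<Rightarrow> bool" where
  "linked f [] = True"
| "linked f (j # js) = (f j = link js \<and> linked f js)"

lemma linked_upd: "j \<notin> set js \<Longrightarrow> linked (f(j := v)) js = linked f js"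
  by (induction js) auto

definition holds_input :: "batch_instance \<Rightarrow> real \<Rightarrow> ram_state \<Rightarrow> bool" where
  "holds_input I T s \<longleftrightarrow> nats s ''n'' 0 = num_jobs I \<and> nats s ''c'' 0 = num_classes I \<and>
     reals s ''T'' 0 = T \<and> (\<forall>i<num_classes I. reals s ''s'' i = stime I i) \<and>
     (\<forall>j<num_jobs I. reals s ''t'' j = real (proc_time I j))"

definition holds_lists :: "batch_instance \<Rightarrow> ram_state \<Rightarrow> bool" where
  "holds_lists I s \<longleftrightarrow> (\<forall>i<num_classes I. nats s ''head'' i = link (class_jobs I i) \<and>
     linked (nats s ''next'') (class_jobs I i) \<and> reals s ''P'' i = class_load I i)"

definition holds_alpha :: "batch_instance \<Rightarrow> real \<Rightarrow> ram_state \<Rightarrow> bool" where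
  "holds_alpha I T s \<longleftrightarrow> (\<forall>i<num_classes I. nats s ''alpha'' i = alpha' I T i)"

definition holds_data :: "batch_instance \<Rightarrow> real \<Rightarrow> ram_state \<Rightarrow> bool" where
  "holds_data I T s \<longleftrightarrow> holds_input I T s \<and> holds_lists I s \<and> holds_alpha I T s"

fun holds_schedule :: "nat \<times> real \<times> schedule \<Rightarrow> ram_state \<Rightarrow> bool" where
  "holds_schedule (u, p, \<sigma>) s \<longleftrightarrow>
     nats s ''u'' 0 = u \<and> reals s ''p'' 0 = p \<and> output_schedule s = \<sigma>"

lemma holds_data_cong:
  assumes "\<And>x. x \<in> {''n'', ''c'', ''head'', ''next'', ''alpha''} \<Longrightarrow> nats s' x = nats s x"
    and "\<And>x. x \<in> {''T'', ''s'', ''t'', ''P''} \<Longrightarrow> reals s' x = reals s x"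
  shows "holds_data I T s' = holds_data I T s"
  using assms by (simp add: holds_data_def holds_input_def holds_lists_def holds_alpha_def)

lemma holds_data_simps [simp]:
  "x \<notin> {''n'', ''c'', ''head'', ''next'', ''alpha''} \<Longrightarrow>
    holds_data I T (nat_update x k v s) = holds_data I T s"
  "y \<notin> {''T'', ''s'', ''t'', ''P''} \<Longrightarrow>
    holds_data I T (real_update y k r s) = holds_data I T s"
  "holds_data I T (add_entry q i a d s) = holds_data I T s"
  by (rule holds_data_cong; force)+

section \<open>Programs for one class and for one pass\<close>

abbreviation setup_exp :: rexp where "setup_exp \<equiv> RGet ''s'' (nvar ''i'')"
abbreviation load_exp :: rexp where "load_exp \<equiv> RGet ''P'' (nvar ''i'')"
abbreviation job_exp :: nexp where "job_exp \<equiv> NSub (nvar ''j'') (NConst 1)"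
abbreviation time_exp :: rexp where "time_exp \<equiv> RGet ''t'' job_exp"

abbreviation incr :: "string \<Rightarrow> com" where
  "incr x \<equiv> NSet x (NConst 0) (NAdd (nvar x) (NConst 1))"

definition setup_prog :: com where
  "setup_prog = Cond (RLess (rvar ''l'') (RAdd (rvar ''p'') setup_exp))
     (Seq (incr ''u'')
     (Seq (emit 0 (nvar ''i'') (RSub (rvar ''b'') setup_exp) setup_exp)
          (RSet ''p'' (NConst 0) (rvar ''b''))))
     (Seq (emit 0 (nvar ''i'') (rvar ''p'') setup_exp)
          (RSet ''p'' (NConst 0) (RAdd (rvar ''p'') setup_exp)))"

abbreviation excess_exp :: rexp where
  "excess_exp \<equiv> RSub (RAdd (rvar ''p'') time_exp) (rvar ''l'')"

text \<open>\<open>p\<close> is overwritten only once \<open>excess_exp\<close>, which refers to its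
  old value, has been evaluated for the last time.\<close>

definition job_prog :: com where
  "job_prog =
     Seq (Cond (RLess (rvar ''l'') (RAdd (rvar ''p'') time_exp))
       (Seq (Cond (RLess (rvar ''p'') (rvar ''l''))
              (emit 1 job_exp (rvar ''p'') (RSub (rvar ''l'') (rvar ''p''))) Skip)
       (Seq (incr ''u'')
       (Seq (emit 0 (nvar ''i'') (RSub (rvar ''b'') setup_exp) setup_exp)
       (Seq (emit 1 job_exp (rvar ''b'') excess_exp)
            (RSet ''p'' (NConst 0) (RAdd (rvar ''b'') excess_exp))))))
       (Seq (emit 1 job_exp (rvar ''p'') time_exp)
            (RSet ''p'' (NConst 0) (RAdd (rvar ''p'') time_exp))))
    (NSet ''j'' (NConst 0) (NGet ''next'' job_exp))"

definition in_class :: "batch_instance \<Rightarrow> real \<Rightarrow> nat \<Rightarrow> real \<Rightarrow> real \<Rightarrow> nat \<times> real \<times> schedule \<Rightarrow>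
    ram_state \<Rightarrow> bool" where
  "in_class I T i b l a s \<longleftrightarrow> holds_data I T s \<and> nats s ''i'' 0 = i \<and> reals s ''b'' 0 = b \<and>
     reals s ''l'' 0 = l \<and> holds_schedule a s"

lemma setup_prog_run:
  assumes "in_class I T i b l a s" "i < num_classes I"
  shows "in_class I T i b l (setup_step I i b l a) (run setup_prog s)"
proof -
  have "reals s ''s'' i = stime I i"
    using assms by (simp add: in_class_def holds_data_def holds_input_def)
  then show ?thesis using assms
    by (cases a) (auto simp: in_class_def setup_prog_def Let_def)
qed

lemma job_prog_run:
  assumes "in_class I T i b l a s" "i < num_classes I" "nats s ''j'' 0 = Suc j" "j < num_jobs I"
  shows "in_class I T i b l (job_step I i b l j a) (run job_prog s) \<and>
    nats (run job_prog s) ''j'' 0 = nats s ''next'' j"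
proof -
  have "reals s ''s'' i = stime I i" "reals s ''t'' j = real (proc_time I j)"
    using assms by (simp_all add: in_class_def holds_data_def holds_input_def)
  then show ?thesis using assms
    by (cases a) (auto simp: in_class_def job_prog_def Let_def)
qed

definition class_prog :: com where
  "class_prog = Seq setup_prog (Seq (NSet ''j'' (NConst 0) (NGet ''head'' (nvar ''i'')))
     (While (NLess (NConst 0) (nvar ''j'')) job_prog))"

lemma loop_free_setup_prog: "loop_free setup_prog" and loop_free_job_prog: "loop_free job_prog"
  by (simp_all add: setup_prog_def job_prog_def)

text \<open>Each iteration handles one job and follows its \<open>next\<close> reference, so the
  cost is a constant plus a constant per job. The rest of the list stays intact because
  \<open>job_prog\<close> does not write \<open>next\<close>.\<close>

lemma class_prog_reaches:
  assumes "in_class I T i b l a s" "i < num_classes I"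
  shows "reaches class_prog s
    (12 + cost setup_prog + (cost job_prog + 6) * length (class_jobs I i))
    (in_class I T i b l (run_class I i b l (class_jobs I i) a))"
proof -
  define Inv where "Inv js a s \<longleftrightarrow> in_class I T i b l a s \<and> set js \<subseteq> {..<num_jobs I} \<and>
    nats s ''j'' 0 = link js \<and> linked (nats s ''next'') js" for js a s
  let ?a = "setup_step I i b l a"
  let ?n = "NSet ''j'' (NConst 0) (NGet ''head'' (nvar ''i''))"
  have fr: "nats (run job_prog s) ''next'' = nats s ''next''" for s
    by (simp add: job_prog_def)
  have raw: "reaches (While (NLess (NConst 0) (nvar ''j'')) job_prog) s
     ((\<Sum>x\<leftarrow>js. 1 + bcost (NLess (NConst 0) (nvar ''j'')) + cost job_prog)
       + 1 + bcost (NLess (NConst 0) (nvar ''j''))) (Inv [] (fold (job_step I i b l) js a))"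
    if "Inv js a s" for js a s
  proof (rule reaches_While_list[where Inv = Inv])
    fix x xs a s
    assume A: "Inv (x # xs) a s"
    then have x: "in_class I T i b l a s" "nats s ''j'' 0 = Suc x" "x < num_jobs I"
      by (auto simp: Inv_def)
    have "Inv xs (job_step I i b l x a) (run job_prog s)"
      using job_prog_run[OF x(1) assms(2) x(2,3)] A fr by (simp add: Inv_def)
    then show "beval (NLess (NConst 0) (nvar ''j'')) s \<and>
        reaches job_prog s (cost job_prog) (Inv xs (job_step I i b l x a))"
      using x(2) by (simp add: reaches_run loop_free_job_prog)
  qed (use that in \<open>auto simp: Inv_def\<close>)
  have loop: "reaches (While (NLess (NConst 0) (nvar ''j'')) job_prog) s
     ((cost job_prog + 5) * length js + 5) (Inv [] (fold (job_step I i b l) js a))"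
    if "Inv js a s" for js a s
    by (rule reaches_mono[OF raw[OF that]]) (simp_all add: sum_list_triv algebra_simps)
  have in1: "in_class I T i b l ?a (run setup_prog s)" using setup_prog_run[OF assms] .
  have "set (class_jobs I i) \<subseteq> {..<num_jobs I}"
    by (auto simp: set_class_jobs jobs_of_class_def)
  moreover have "holds_lists I (run setup_prog s)"
    using in1 by (simp add: in_class_def holds_data_def)
  ultimately have "Inv (class_jobs I i) ?a (run ?n (run setup_prog s))"
    using assms(2) in1 by (cases ?a) (simp add: Inv_def in_class_def holds_lists_def)
  note R = reaches_run_Seq[of ?n, OF _ loop[OF this]]
  show ?thesis unfolding class_prog_def
    by (rule reaches_mono[OF reaches_run_Seq[OF loop_free_setup_prog R]])
      (auto simp: Inv_def run_class_def)
qed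

definition pass_prog :: "bexp \<Rightarrow> rexp \<Rightarrow> rexp \<Rightarrow> com \<Rightarrow> com" where
  "pass_prog cond be le post = Seq (NSet ''i'' (NConst 0) (NConst 0))
     (While (NLess (nvar ''i'') (nvar ''c''))
       (Seq (Cond cond
          (Seq (Seq (RSet ''b'' (NConst 0) be) (RSet ''l'' (NConst 0) le)) (Seq class_prog post)) Skip)
        (incr ''i'')))"

definition good_state :: "batch_instance \<Rightarrow> real \<Rightarrow> nat \<times> real \<times> schedule \<Rightarrow> ram_state \<Rightarrow> bool" where
  "good_state I T a s \<longleftrightarrow> holds_data I T s \<and> holds_schedule a s"

text \<open>A class costs a constant plus a constant for each of its jobs; since the classes
  partition the jobs, the sum is linear in \<open>num_classes I + num_jobs I\<close>.\<close>

lemma pass_prog_reaches: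
  assumes wf: "wf_instance I"
    and cond: "\<And>i s. i < num_classes I \<Longrightarrow> holds_data I T s \<Longrightarrow> nats s ''i'' 0 = i \<Longrightarrow>
      beval cond s \<longleftrightarrow> i \<in> C"
    and be: "\<And>i s. i < num_classes I \<Longrightarrow> holds_data I T s \<Longrightarrow> nats s ''i'' 0 = i \<Longrightarrow> reval be s = b i"
    and le: "\<And>i s. i < num_classes I \<Longrightarrow> holds_data I T s \<Longrightarrow> nats s ''i'' 0 = i \<Longrightarrow> reval le s = l i"
    and post: "loop_free post" "\<And>a s. good_state I T a s \<Longrightarrow>
      good_state I T (f a) (run post s) \<and> nats (run post s) ''i'' 0 = nats s ''i'' 0"
    and s: "good_state I T a s"
  shows "reaches (pass_prog cond be le post) s
    ((bcost cond + rcost be + rcost le + cost setup_prog + cost post + cost job_prog + 60)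
       * (num_classes I + num_jobs I + 1))
    (good_state I T (run_pass I C b l f (num_classes I) a))"
proof -
  let ?c = "num_classes I"
  let ?g = "\<lambda>i a. if i \<in> C then f (run_class I i (b i) (l i) (class_jobs I i) a) else a"
  let ?len = "\<lambda>i. length (class_jobs I i)"
  let ?set = "Seq (RSet ''b'' (NConst 0) be) (RSet ''l'' (NConst 0) le)"
  let ?test = "NLess (nvar ''i'') (nvar ''c'')"
  define body where "body = Seq (Cond cond (Seq ?set (Seq class_prog post)) Skip) (incr ''i'')"
  \<comment> \<open>\<open>K\<close> bounds the work per class and \<open>J\<close> the work per
    job; the 30 absorbs assignments, tests and command nodes.\<close>
  define K where "K = bcost cond + rcost be + rcost le + cost setup_prog + cost post + 30"
  define J where "J = cost job_prog + 6"
  define Inv where "Inv xs a s \<longleftrightarrow> good_state I T a s \<and> nats s ''i'' 0 \<le> ?c \<and>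
    [nats s ''i'' 0..<?c] = xs" for xs a s
  have step: "beval ?test s \<and> reaches body s (K + J * ?len i) (Inv xs (?g i a))"
    if A: "Inv (i # xs) a s" for i xs a s
  proof
    have "[nats s ''i'' 0..<?c] = i # xs" using A by (simp add: Inv_def)
    then have i: "nats s ''i'' 0 = i" "i < ?c" "xs = [Suc i..<?c]"
      by (auto simp: upt_eq_Cons_conv)
    have gs: "good_state I T a s" and hd: "holds_data I T s"
      using A by (auto simp: Inv_def good_state_def)
    show "beval ?test s" using i hd by (simp add: holds_data_def holds_input_def)
    have next': "reaches (incr ''i'') s' 6 (Inv xs a')"
      if "good_state I T a' s'" "nats s' ''i'' 0 = i" for a' s'
      by (rule reaches_mono[OF reaches_run[where Q = "Inv xs a'"]])
        (use that i in \<open>cases a'; simp add: Inv_def good_state_def\<close>)+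
    \<comment> \<open>The 8 steps held back pay for the nodes \<open>Seq\<close> and
      \<open>Cond\<close> and for the 6 steps of \<open>incr\<close>.\<close>
    have "reaches (Cond cond (Seq ?set (Seq class_prog post)) Skip) s
       (1 + bcost cond + (K - bcost cond - 8 + J * ?len i))
       (\<lambda>s'. good_state I T (?g i a) s' \<and> nats s' ''i'' 0 = i)"
    proof (rule reaches_Cond)
      assume "\<not> beval cond s"
      then have "i \<notin> C" using cond[OF i(2) hd i(1)] by simp
      then show "reaches Skip s (K - bcost cond - 8 + J * ?len i)
          (\<lambda>s'. good_state I T (?g i a) s' \<and> nats s' ''i'' 0 = i)"
        by (intro reaches_mono[OF reaches_run[where Q = "\<lambda>s'. s' = s"]])
          (auto simp: gs i K_def)
    next
      assume "beval cond s"
      then have C: "i \<in> C" using cond[OF i(2) hd i(1)] by simp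
      define s1 where "s1 = run ?set s"
      have "in_class I T i (b i) (l i) a s1"
        using gs i be[OF i(2) hd i(1)] le[OF i(2), of "real_update ''b'' 0 (b i) s"] hd
        by (cases a) (simp add: s1_def in_class_def good_state_def)
      from class_prog_reaches[OF this i(2)]
      have "reaches class_prog s1 (12 + cost setup_prog + J * ?len i)
        (\<lambda>s'. reaches post s' (cost post)
          (\<lambda>s'. good_state I T (?g i a) s' \<and> nats s' ''i'' 0 = i))"
        unfolding J_def
      proof (rule reaches_mono)
        fix s'
        assume "in_class I T i (b i) (l i) (run_class I i (b i) (l i) (class_jobs I i) a) s'"
        then have "good_state I T (run_class I i (b i) (l i) (class_jobs I i) a) s'"
          "nats s' ''i'' 0 = i" by (simp_all add: in_class_def good_state_def)
        then show "reaches post s' (cost post)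
          (\<lambda>s'. good_state I T (?g i a) s' \<and> nats s' ''i'' 0 = i)"
          using post C by (intro reaches_run) auto
      qed simp
      note R = reaches_Seq[OF this, unfolded s1_def]
      show "reaches (Seq ?set (Seq class_prog post)) s (K - bcost cond - 8 + J * ?len i)
          (\<lambda>s'. good_state I T (?g i a) s' \<and> nats s' ''i'' 0 = i)"
        by (rule reaches_mono[OF reaches_run_Seq[OF _ R]]) (auto simp: K_def)
    qed
    then have "reaches (Cond cond (Seq ?set (Seq class_prog post)) Skip) s
       (1 + bcost cond + (K - bcost cond - 8 + J * ?len i)) (\<lambda>s'. reaches (incr ''i'') s' 6 (Inv xs (?g i a)))"
      by (rule reaches_mono) (use next' in auto)
    from reaches_Seq[OF this] show "reaches body s (K + J * ?len i) (Inv xs (?g i a))"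
      unfolding body_def by (rule reaches_mono) (auto simp: K_def)
  qed
  have init: "Inv [0..<?c] a (run (NSet ''i'' (NConst 0) (NConst 0)) s)"
    using s by (cases a) (simp add: Inv_def good_state_def)
  have W: "reaches (While ?test body) (run (NSet ''i'' (NConst 0) (NConst 0)) s)
      ((\<Sum>x\<leftarrow>[0..<?c]. 1 + bcost ?test + (K + J * ?len x)) + 1 + bcost ?test)
      (Inv [] (fold ?g [0..<?c] a))"
    by (rule reaches_While_list[where Inv = Inv, OF step _ init])
      (auto simp: Inv_def good_state_def holds_data_def holds_input_def)
  have S: "(\<Sum>x\<leftarrow>[0..<?c]. 1 + bcost ?test + (K + J * ?len x)) = (K + 6) * ?c + J * num_jobs I"
  proof -
    have "(\<Sum>x\<leftarrow>[0..<?c]. 1 + bcost ?test + (K + J * ?len x)) =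
        (\<Sum>x<?c. (K + 6) + J * card (jobs_of_class I x))"
      by (auto simp: sum_list_distinct_conv_sum_set length_class_jobs atLeast0LessThan
          intro!: sum.cong)
    also have "\<dots> = (K + 6) * ?c + J * num_jobs I"
      by (simp only: sum.distrib sum_distrib_left[symmetric] sum_card_classes[OF wf])
        (simp add: algebra_simps)
    finally show ?thesis .
  qed
  have "reaches (While ?test body) (run (NSet ''i'' (NConst 0) (NConst 0)) s)
      ((K + 6) * ?c + J * num_jobs I + 6) (Inv [] (fold ?g [0..<?c] a))"
    by (rule reaches_mono[OF W[unfolded S]]) simp_all
  note R = reaches_run_Seq[of "NSet ''i'' (NConst 0) (NConst 0)", OF _ this]
  show ?thesis
    unfolding pass_prog_def body_def[symmetric]
    by (rule reaches_mono[OF R])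
      (auto simp: Inv_def run_pass_def K_def J_def algebra_simps)
qed

section \<open>Preprocessing: job lists, class loads and the values \<open>alpha'\<close>\<close>

definition lists_prog :: com where
  "lists_prog = While (NLess (nvar ''j'') (nvar ''n''))
     (Seq (NSet ''next'' (nvar ''j'') (NGet ''head'' (NGet ''class'' (nvar ''j''))))
     (Seq (NSet ''head'' (NGet ''class'' (nvar ''j'')) (NAdd (nvar ''j'') (NConst 1)))
     (Seq (RSet ''P'' (NGet ''class'' (nvar ''j''))
            (RAdd (RGet ''P'' (NGet ''class'' (nvar ''j''))) (RGet ''t'' (nvar ''j''))))
          (incr ''j''))))"

text \<open>The zeroed memory encodes the empty schedule; the zero at \<open>i\<close> is recorded
  because \<open>alpha_prog\<close> starts there without initialising \<open>i\<close>.\<close>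

definition fresh :: "batch_instance \<Rightarrow> real \<Rightarrow> ram_state \<Rightarrow> bool" where
  "fresh I T s \<longleftrightarrow> holds_input I T s \<and> holds_schedule (0, 0, []) s \<and> nats s ''i'' 0 = 0"

text \<open>After \<open>k\<close> rounds the list of each class holds its jobs below
  \<open>k\<close> in decreasing order; prepending job \<open>k\<close> to the list of its class
  turns \<open>js k\<close> into \<open>js (Suc k)\<close>.\<close>

lemma lists_prog_reaches:
  assumes wf: "wf_instance I"
  shows "reaches lists_prog (input_state I T) (45 * num_jobs I + 6)
    (\<lambda>s. fresh I T s \<and> holds_lists I s \<and> nats s ''alpha'' = (\<lambda>_. 0))"
proof -
  define js where "js k i = rev (filter (\<lambda>j. class_of I j = i) [0..<k])" for k i
  have js_Suc: "js (Suc k) i = (if class_of I k = i then k # js k i else js k i)" for k i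
    by (simp add: js_def)
  have js_notin: "k \<notin> set (js k i)" for k i by (simp add: js_def)
  define Inv where "Inv s \<longleftrightarrow> fresh I T s \<and> nats s ''alpha'' = (\<lambda>_. 0) \<and>
    (\<forall>k<num_jobs I. nats s ''class'' k = class_of I k) \<and> nats s ''j'' 0 \<le> num_jobs I \<and>
    (\<forall>i. nats s ''head'' i = link (js (nats s ''j'' 0) i) \<and>
       linked (nats s ''next'') (js (nats s ''j'' 0) i) \<and>
       (i < num_classes I \<longrightarrow>
         reals s ''P'' i = (\<Sum>j\<leftarrow>js (nats s ''j'' 0) i. real (proc_time I j))))" for s
  let ?test = "NLess (nvar ''j'') (nvar ''n'')"
  define body where "body = (case lists_prog of While b c \<Rightarrow> c)"
  have lp: "lists_prog = While ?test body" by (simp add: lists_prog_def body_def)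
  have "reaches lists_prog (input_state I T) ((1 + bcost ?test + cost body) * num_jobs I + 1 + bcost ?test)
      (\<lambda>s. Inv s \<and> \<not> beval ?test s)"
    unfolding lp
  proof (rule reaches_While_measure[where \<mu> = "\<lambda>s. num_jobs I - nats s ''j'' 0"])
    show "Inv (input_state I T)"
      by (auto simp: Inv_def fresh_def input_state_def holds_input_def output_schedule_def js_def)
  next
    fix s
    assume A: "Inv s" and b: "beval ?test s"
    define k where "k = nats s ''j'' 0"
    have k: "k < num_jobs I" using A b by (simp add: Inv_def fresh_def holds_input_def k_def)
    have tk: "reals s ''t'' k = real (proc_time I k)" and ck: "nats s ''class'' k = class_of I k"
      using A k by (auto simp: Inv_def fresh_def holds_input_def)
    have "Inv (run body s) \<and> nats (run body s) ''j'' 0 = Suc k"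
      using A k tk ck
      by (simp add: Inv_def body_def lists_prog_def fresh_def holds_input_def js_Suc linked_upd
          js_notin flip: k_def) 
    then show "reaches body s (cost body)
        (\<lambda>s'. Inv s' \<and> num_jobs I - nats s' ''j'' 0 < num_jobs I - nats s ''j'' 0)"
      using k by (intro reaches_run) (auto simp: k_def body_def lists_prog_def)
  qed simp
  then show ?thesis
  proof (rule reaches_mono)
    fix s
    assume "Inv s \<and> \<not> beval ?test s"
    then have A: "Inv s" "nats s ''j'' 0 = num_jobs I"
      by (auto simp: Inv_def fresh_def holds_input_def)
    have "js (num_jobs I) = class_jobs I" by (auto simp: js_def class_jobs_def)
    then show "fresh I T s \<and> holds_lists I s \<and> nats s ''alpha'' = (\<lambda>_. 0)"
      using A by (simp add: Inv_def holds_lists_def sum_class_jobs)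
  qed (simp add: body_def lists_prog_def)
qed

text \<open>Without a rounding instruction the floor is found by counting: the counter rises as long
  as one more multiple of \<open>T - stime I i\<close> still fits into the load.\<close>

definition alpha_prog :: com where
  "alpha_prog = While (NLess (nvar ''i'') (nvar ''c''))
     (Cond (RLess load_exp (RMul (OfNat (NAdd (NGet ''alpha'' (nvar ''i'')) (NConst 1)))
              (RSub (rvar ''T'') setup_exp)))
        (incr ''i'')
        (NSet ''alpha'' (nvar ''i'') (NAdd (NGet ''alpha'' (nvar ''i'')) (NConst 1))))"

text \<open>The number of rounds is at most the number of classes plus the sum of all
  \<open>alpha'\<close>, hence at most \<open>c + n\<close> by \<open>alpha_le_card\<close>. The
  counting is linear overall although a single class may take many rounds.\<close>

lemma (in bounded_instance) alpha_prog_reaches: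
  assumes s0: "fresh I T s" "holds_lists I s" "nats s ''alpha'' = (\<lambda>_. 0)"
  shows "reaches alpha_prog s (45 * (c + n) + 6) (good_state I T (0, 0, []))"
proof -
  define Inv where "Inv s \<longleftrightarrow> holds_input I T s \<and> holds_lists I s \<and> holds_schedule (0, 0, []) s \<and>
    nats s ''i'' 0 \<le> c \<and> (\<forall>k<c. nats s ''alpha'' k \<le> alpha' I T k) \<and>
    (\<forall>k<nats s ''i'' 0. nats s ''alpha'' k = alpha' I T k)" for s
  \<comment> \<open>Each iteration increments either \<open>i\<close> or one of the counters, none of which exceeds \<open>\<alpha>'\<close>.\<close>
  define \<mu> where "\<mu> s = (c + (\<Sum>k<c. alpha' I T k)) - (nats s ''i'' 0 + (\<Sum>k<c. nats s ''alpha'' k))"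
    for s :: ram_state
  let ?test = "NLess (nvar ''i'') (nvar ''c'')"
  define body where "body = (case alpha_prog of While b d \<Rightarrow> d)"
  have lp: "alpha_prog = While ?test body" by (simp add: alpha_prog_def body_def)
  have "(\<Sum>k<c. alpha' I T k) \<le> n"
    unfolding sum_card_classes[OF wf, symmetric] by (rule sum_mono) (simp add: alpha_le_card)
  then have \<mu>_le: "\<mu> s \<le> c + n" for s by (simp add: \<mu>_def)
  have "reaches alpha_prog s ((1 + bcost ?test + cost body) * (c + n) + 1 + bcost ?test)
      (\<lambda>s. Inv s \<and> \<not> beval ?test s)"
    unfolding lp
  proof (rule reaches_While_measure[where \<mu> = \<mu>])
    show "Inv s" using s0 by (simp add: Inv_def fresh_def)
  next
    fix s
    assume A: "Inv s" and b: "beval ?test s"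
    define i where "i = nats s ''i'' 0"
    have i: "i < c" using A b by (simp add: Inv_def holds_input_def i_def)
    have vals: "reals s ''T'' 0 = T" "reals s ''s'' i = stime I i" "reals s ''P'' i = class_load I i"
      using A i by (auto simp: Inv_def holds_input_def holds_lists_def)
    have le: "nats s ''alpha'' k \<le> alpha' I T k" if "k < c" for k
      using A that by (simp add: Inv_def)
    \<comment> \<open>This makes the measure positive, without which truncated subtraction could not
      decrease.\<close>
    have lt: "i + (\<Sum>k<c. nats s ''alpha'' k) < c + (\<Sum>k<c. alpha' I T k)"
      using i sum_mono[of "{..<c}" "nats s ''alpha''" "alpha' I T"] le by auto
    have pos: "0 < T - stime I i" using setup_less[OF i] by simp
    let ?a = "nats s ''alpha'' i"
    have "Inv (run body s) \<and> \<mu> (run body s) < \<mu> s"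
    proof (cases "class_load I i < (real ?a + 1) * (T - stime I i)")
      case True
      have "real (alpha' I T i) * (T - stime I i) < (real ?a + 1) * (T - stime I i)"
        using alpha_mult_le[OF i] True by linarith
      then have "alpha' I T i \<le> ?a" using pos by simp
      then have eq: "?a = alpha' I T i" using le[OF i] by simp
      have r: "run body s = nat_update ''i'' 0 (Suc i) s"
        using True vals by (simp add: body_def alpha_prog_def add.commute flip: i_def)
      show ?thesis unfolding r
        using A i eq lt
        by (auto simp: Inv_def \<mu>_def holds_input_def holds_lists_def less_Suc_eq simp flip: i_def)
    next
      case False
      have "(real ?a + 1) * (T - stime I i) < (real (alpha' I T i) + 1) * (T - stime I i)"
        using alpha_Suc_mult_gr[OF i] False by linarith
      then have lt': "Suc ?a \<le> alpha' I T i" using pos by simp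
      have r: "run body s = nat_update ''alpha'' i (Suc ?a) s"
        using False vals by (simp add: body_def alpha_prog_def add.commute flip: i_def)
      have "(\<Sum>k<c. ((nats s ''alpha'')(i := Suc ?a)) k) = Suc (\<Sum>k<c. nats s ''alpha'' k)"
        using i by (simp add: sum.remove[of "{..<c}" i])
      then show ?thesis unfolding r
        using A i lt lt'
        by (auto simp: Inv_def \<mu>_def holds_input_def holds_lists_def simp flip: i_def)
    qed
    then show "reaches body s (cost body) (\<lambda>s'. Inv s' \<and> \<mu> s' < \<mu> s)"
      by (intro reaches_run) (auto simp: body_def alpha_prog_def)
  qed (rule \<mu>_le)
  then show ?thesis
    by (rule reaches_mono)
      (auto simp: body_def alpha_prog_def Inv_def good_state_def holds_data_def holds_input_def
        holds_alpha_def)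
qed

section \<open>The complete program and its running time\<close>

abbreviation two_exp :: rexp where "two_exp \<equiv> OfNat (NConst 2)"
abbreviation three_exp :: rexp where "three_exp \<equiv> OfNat (NConst 3)"
abbreviation four_exp :: rexp where "four_exp \<equiv> OfNat (NConst 4)"
abbreviation half_exp :: rexp where "half_exp \<equiv> RDiv (rvar ''T'') two_exp"
abbreviation top_exp :: rexp where "top_exp \<equiv> RDiv (RMul three_exp (rvar ''T'')) two_exp"
abbreviation expensive_exp :: bexp where
  "expensive_exp \<equiv> RLess (rvar ''T'') (RMul two_exp setup_exp)"

definition plus_prog :: com where
  "plus_prog = pass_prog
     (BAnd expensive_exp (BNot (RLess (RAdd setup_exp load_exp) (rvar ''T''))))
     setup_exp (RAdd setup_exp (RDiv load_exp (OfNat (NGet ''alpha'' (nvar ''i'')))))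
     (Seq (incr ''u'') (RSet ''p'' (NConst 0) (OfNat (NConst 0))))"

definition minus_prog :: com where
  "minus_prog = pass_prog
     (BAnd expensive_exp (BNot (RLess (RMul three_exp (rvar ''T''))
       (RMul four_exp (RAdd setup_exp load_exp)))))
     setup_exp top_exp
     (Cond (RLess (RMul three_exp (rvar ''T'')) (RMul four_exp (rvar ''p'')))
       (Seq (incr ''u'') (RSet ''p'' (NConst 0) (OfNat (NConst 0)))) Skip)"

definition gap_prog :: com where
  "gap_prog = Cond (RLess (OfNat (NConst 0)) (rvar ''p''))
     (RSet ''p'' (NConst 0) (rvar ''T'')) (RSet ''p'' (NConst 0) half_exp)"

definition cheap_prog :: com where
  "cheap_prog = pass_prog (BNot expensive_exp) half_exp top_exp Skip"

definition schedule_prog :: com where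
  "schedule_prog = Seq lists_prog (Seq alpha_prog (Seq plus_prog (Seq minus_prog
     (Seq gap_prog cheap_prog))))"

lemma holds_data_values:
  assumes "holds_data I T s"
  shows "reals s ''T'' 0 = T"
    and "i < num_classes I \<Longrightarrow> reals s ''s'' i = stime I i \<and> reals s ''P'' i = class_load I i \<and>
      nats s ''alpha'' i = alpha' I T i"
  using assms by (auto simp: holds_data_def holds_input_def holds_lists_def holds_alpha_def)

text \<open>\<open>K\<close> is introduced as a schematic variable and filled by
  \<open>pass_prog_reaches\<close> with an expression in the program alone, so it is uniform in
  \<open>I\<close> and \<open>T\<close>.\<close>

lemma plus_prog_reaches:
  "\<exists>K. \<forall>I T s a. wf_instance I \<longrightarrow> good_state I T a s \<longrightarrow>
     reaches plus_prog s (K * (num_classes I + num_jobs I + 1))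
       (good_state I T (run_pass I (I_exp_plus I T) (stime I)
         (\<lambda>i. stime I i + class_load I i / real (alpha' I T i)) next_machine (num_classes I) a))"
  unfolding plus_prog_def
proof (intro exI allI impI, rule pass_prog_reaches)
  fix I T i s
  assume i: "i < num_classes I" "holds_data I T s" "nats s ''i'' 0 = i"
  note v = holds_data_values(1)[OF i(2)] holds_data_values(2)[OF i(2,1)]
  show "beval (BAnd expensive_exp (BNot (RLess (RAdd setup_exp load_exp) (rvar ''T'')))) s \<longleftrightarrow>
      i \<in> I_exp_plus I T"
    using v i by (auto simp: I_exp_plus_def I_exp_def)
  show "reval setup_exp s = stime I i"
    "reval (RAdd setup_exp (RDiv load_exp (OfNat (NGet ''alpha'' (nvar ''i''))))) s =
      stime I i + class_load I i / real (alpha' I T i)"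
    using v i by auto
next
  fix I T s and a :: "nat \<times> real \<times> schedule"
  assume "good_state I T a s"
  then show "good_state I T (next_machine a)
      (run (Seq (incr ''u'') (RSet ''p'' (NConst 0) (OfNat (NConst 0)))) s) \<and>
    nats (run (Seq (incr ''u'') (RSet ''p'' (NConst 0) (OfNat (NConst 0)))) s) ''i'' 0 =
      nats s ''i'' 0"
    by (cases a) (simp add: good_state_def)
qed auto

lemma minus_prog_reaches:
  "\<exists>K. \<forall>I T s a. wf_instance I \<longrightarrow> good_state I T a s \<longrightarrow>
     reaches minus_prog s (K * (num_classes I + num_jobs I + 1))
       (good_state I T (run_pass I (I_exp_minus I T) (stime I) (\<lambda>i. 3 * T / 2)
         (close_if_full T) (num_classes I) a))"
  unfolding minus_prog_def
proof (intro exI allI impI, rule pass_prog_reaches)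
  fix I T i s
  assume i: "i < num_classes I" "holds_data I T s" "nats s ''i'' 0 = i"
  note v = holds_data_values(1)[OF i(2)] holds_data_values(2)[OF i(2,1)]
  show "beval (BAnd expensive_exp (BNot (RLess (RMul three_exp (rvar ''T''))
       (RMul four_exp (RAdd setup_exp load_exp))))) s \<longleftrightarrow> i \<in> I_exp_minus I T"
    using v i by (auto simp: I_exp_minus_def I_exp_def)
  show "reval setup_exp s = stime I i" "reval top_exp s = 3 * T / 2"
    using v i by auto
next
  fix I T s and a :: "nat \<times> real \<times> schedule"
  let ?post = "Cond (RLess (RMul three_exp (rvar ''T'')) (RMul four_exp (rvar ''p'')))
       (Seq (incr ''u'') (RSet ''p'' (NConst 0) (OfNat (NConst 0)))) Skip"
  assume "good_state I T a s"
  then show "good_state I T (close_if_full T a) (run ?post s) \<and>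
      nats (run ?post s) ''i'' 0 = nats s ''i'' 0"
    using holds_data_values(1)[of I T s] by (cases a) (auto simp: good_state_def)
qed auto

lemma cheap_prog_reaches:
  "\<exists>K. \<forall>I T s a. wf_instance I \<longrightarrow> good_state I T a s \<longrightarrow>
     reaches cheap_prog s (K * (num_classes I + num_jobs I + 1))
       (good_state I T (run_pass I (I_chp I T) (\<lambda>i. T / 2) (\<lambda>i. 3 * T / 2) id
         (num_classes I) a))"
  unfolding cheap_prog_def
proof (intro exI allI impI, rule pass_prog_reaches)
  fix I T i s
  assume i: "i < num_classes I" "holds_data I T s" "nats s ''i'' 0 = i"
  note v = holds_data_values(1)[OF i(2)] holds_data_values(2)[OF i(2,1)]
  show "beval (BNot expensive_exp) s \<longleftrightarrow> i \<in> I_chp I T"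
    using v i by (auto simp: I_chp_def)
  show "reval half_exp s = T / 2" "reval top_exp s = 3 * T / 2"
    using v i by auto
qed auto

lemma gap_prog_run:
  assumes "good_state I T a s"
  shows "good_state I T (first_gap T a) (run gap_prog s)"
  using assms holds_data_values(1)[of I T s]
  by (cases a) (auto simp: good_state_def gap_prog_def)

text \<open>A pass costs a multiple of \<open>c + n + 1\<close>. No class is empty and there is a
  job, so this is at most \<open>3 * n\<close>; hence the factor 3 in \<open>K\<close>, while the 20
  covers additive constants.\<close>

lemma schedule_prog_reaches:
  "\<exists>K. \<forall>I T. wf_instance I \<longrightarrow> T_min I \<le> T \<longrightarrow>
     reaches schedule_prog (input_state I T) (K * num_jobs I)
       (good_state I T (pass_cheap I T (num_classes I)))"
proof -
  obtain Kp where Kp: "\<forall>I T s a. wf_instance I \<longrightarrow> good_state I T a s \<longrightarrow>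
     reaches plus_prog s (Kp * (num_classes I + num_jobs I + 1))
       (good_state I T (run_pass I (I_exp_plus I T) (stime I)
         (\<lambda>i. stime I i + class_load I i / real (alpha' I T i)) next_machine (num_classes I) a))"
    using plus_prog_reaches ..
  obtain Km where Km: "\<forall>I T s a. wf_instance I \<longrightarrow> good_state I T a s \<longrightarrow>
     reaches minus_prog s (Km * (num_classes I + num_jobs I + 1))
       (good_state I T (run_pass I (I_exp_minus I T) (stime I) (\<lambda>i. 3 * T / 2)
         (close_if_full T) (num_classes I) a))"
    using minus_prog_reaches ..
  obtain Kc where Kc: "\<forall>I T s a. wf_instance I \<longrightarrow> good_state I T a s \<longrightarrow>
     reaches cheap_prog s (Kc * (num_classes I + num_jobs I + 1))
       (good_state I T (run_pass I (I_chp I T) (\<lambda>i. T / 2) (\<lambda>i. 3 * T / 2) id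
         (num_classes I) a))"
    using cheap_prog_reaches ..
  define K where "K = 3 * (45 + 45 + Kp + Km + Kc + cost gap_prog + 20)"
  have "reaches schedule_prog (input_state I T) (K * num_jobs I)
       (good_state I T (pass_cheap I T (num_classes I)))"
    if wf: "wf_instance I" and T: "T_min I \<le> T" for I T
  proof -
    interpret bounded_instance I T by standard fact+
    let ?G = "good_state I T" and ?N = "c + n + 1"
    have cheap: "reaches cheap_prog s (Kc * ?N) (?G (pass_cheap I T c))"
      if "?G (first_gap T (pass_minus I T c)) s" for s
      using Kc[rule_format, OF wf that] by (simp add: pass_cheap_def)
    have gap: "reaches (Seq gap_prog cheap_prog) s (1 + cost gap_prog + Kc * ?N)
        (?G (pass_cheap I T c))" if "?G (pass_minus I T c) s" for s
      by (rule reaches_run_Seq[OF _ cheap[OF gap_prog_run[OF that]]]) (simp add: gap_prog_def)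
    have minus: "reaches (Seq minus_prog (Seq gap_prog cheap_prog)) s
        (1 + Km * ?N + (1 + cost gap_prog + Kc * ?N)) (?G (pass_cheap I T c))"
      if "?G (pass_plus I T c) s" for s
      by (rule reaches_Seq, rule reaches_mono[OF Km[rule_format, OF wf that]])
        (use gap in \<open>auto simp: pass_minus_def\<close>)
    have plus: "reaches (Seq plus_prog (Seq minus_prog (Seq gap_prog cheap_prog))) s
        (1 + Kp * ?N + (1 + Km * ?N + (1 + cost gap_prog + Kc * ?N))) (?G (pass_cheap I T c))"
      if "?G (0, 0, []) s" for s
      by (rule reaches_Seq, rule reaches_mono[OF Kp[rule_format, OF wf that]])
        (use minus in \<open>auto simp: pass_plus_def\<close>)
    have alpha: "reaches (Seq alpha_prog (Seq plus_prog (Seq minus_prog (Seq gap_prog cheap_prog)))) s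
        (1 + (45 * (c + n) + 6) +
          (1 + Kp * ?N + (1 + Km * ?N + (1 + cost gap_prog + Kc * ?N)))) (?G (pass_cheap I T c))"
      if "fresh I T s \<and> holds_lists I s \<and> nats s ''alpha'' = (\<lambda>_. 0)" for s
      by (rule reaches_Seq, rule reaches_mono[OF alpha_prog_reaches]) (use that plus in auto)
    have all: "reaches schedule_prog (input_state I T) (1 + (45 * n + 6) + (1 + (45 * (c + n) + 6) +
          (1 + Kp * ?N + (1 + Km * ?N + (1 + cost gap_prog + Kc * ?N))))) (?G (pass_cheap I T c))"
      unfolding schedule_prog_def
      by (rule reaches_Seq, rule reaches_mono[OF lists_prog_reaches[OF wf]]) (use alpha in auto)
    have n: "1 \<le> n" using wf by (simp add: wf_instance_def)
    have "(\<Sum>i<c. 1) \<le> (\<Sum>i<c. card (jobs_of_class I i))"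
      by (rule sum_mono) (use class_jobs_ne in \<open>simp add: Suc_le_eq card_gt_0_iff\<close>)
    then have "c \<le> n" by (simp add: sum_card_classes[OF wf])
    then have N: "?N \<le> 3 * n" "c + n \<le> 2 * n" using n by auto
    have NK: "K' * ?N \<le> 3 * K' * n" for K' using mult_le_mono2[OF N(1), of K'] by simp
    have N': "(cost gap_prog + 20) * 1 \<le> (cost gap_prog + 20) * n"
      using n by (intro mult_le_mono2)
    have
      "Kp * ?N + Km * ?N + Kc * ?N + 45 * n + 45 * (c + n) + (cost gap_prog + 20) * 1 \<le>
       3 * Kp * n + 3 * Km * n + 3 * Kc * n + 45 * n + 45 * (2 * n) + (cost gap_prog + 20) * n"
      by (intro add_mono NK N' mult_le_mono2[OF N(2)] order_refl)
    also have "\<dots> \<le> K * n" by (simp add: K_def algebra_simps)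
    finally show ?thesis by (intro reaches_mono[OF all]) auto
  qed
  then show ?thesis by blast
qed

section \<open>The lower bound\<close>

lemma sum_list_dur_le:
  assumes "sorted_wrt (\<lambda>d e. finish d \<le> start e) es"
    and "\<And>e. e \<in> set es \<Longrightarrow> a \<le> start e \<and> finish e \<le> B" "a \<le> B"
  shows "(\<Sum>e\<leftarrow>es. dur e) \<le> B - a"
  using assms
proof (induction es arbitrary: a)
  case (Cons e es)
  have "(\<Sum>e\<leftarrow>es. dur e) \<le> B - finish e"
    by (rule Cons.IH) (use Cons.prems in auto)
  moreover have "a \<le> start e" using Cons.prems(2) by simp
  ultimately show ?case by (simp add: finish_def)
qed simp

lemma sum_list_sum_swap:
  "(\<Sum>e\<leftarrow>es. \<Sum>k\<in>A. f k e) = (\<Sum>k\<in>A. \<Sum>e\<leftarrow>es. (f k e :: 'a :: comm_monoid_add))"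
  by (induction es) (simp_all add: sum.distrib)

lemma sum_list_machines:
  fixes g :: "entry \<Rightarrow> 'a :: comm_monoid_add"
  assumes "\<forall>e\<in>set \<sigma>. mach e < m"
  shows "(\<Sum>u<m. \<Sum>e\<leftarrow>on_machine \<sigma> u. g e) = (\<Sum>e\<leftarrow>\<sigma>. g e)"
proof -
  have "(\<Sum>u<m. \<Sum>e\<leftarrow>on_machine \<sigma> u. g e) = (\<Sum>u<m. \<Sum>e\<leftarrow>\<sigma>. if mach e = u then g e else 0)"
    by (simp add: on_machine_def sum_list_map_filter')
  also have "\<dots> = (\<Sum>e\<leftarrow>\<sigma>. \<Sum>u<m. if mach e = u then g e else 0)"
    by (rule sum_list_sum_swap[symmetric])
  also have "\<dots> = (\<Sum>e\<leftarrow>\<sigma>. g e)"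
    using assms by (intro arg_cong[of _ _ sum_list] map_cong) auto
  finally show ?thesis .
qed

text \<open>Walking back from a piece, the predecessors keep its class until a setup is met, and the
  first entry cannot be a piece.\<close>

lemma setup_of_piece:
  assumes "setups_respected I es" "k < length es" "act (es ! k) = Piece j"
  shows "\<exists>e\<in>set es. act e = Setup (class_of I j)"
  using assms(2,3)
proof (induction k arbitrary: j)
  case 0
  then show ?case using assms(1) by (auto simp: setups_respected_def)
next
  case (Suc k)
  have c: "activity_class I (act (es ! k)) = class_of I j"
    using assms(1) Suc.prems unfolding setups_respected_def by fastforce
  show ?case
  proof (cases "act (es ! k)")
    case (Setup i)
    then show ?thesis using c Suc.prems(1) by (auto intro!: bexI[of _ "es ! k"])
  next
    case (Piece j')
    then show ?thesis using Suc.IH[OF _ Piece] Suc.prems(1) c by simp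
  qed
qed

lemma sum_list_0_entries:
  "(\<And>e. e \<in> set es \<Longrightarrow> f e = 0) \<Longrightarrow> (\<Sum>e\<leftarrow>es. f e) = (0 :: real)"
  by (induction es) auto

definition setup_count :: "nat \<Rightarrow> entry list \<Rightarrow> nat" where
  "setup_count i es = (\<Sum>e\<leftarrow>es. if act e = Setup i then 1 else 0)"

lemma setup_count_pos: "e \<in> set es \<Longrightarrow> act e = Setup i \<Longrightarrow> 0 < setup_count i es"
  unfolding setup_count_def by (induction es) auto

definition work :: "nat set \<Rightarrow> entry list \<Rightarrow> real" where
  "work K es = (\<Sum>j\<in>K. \<Sum>e\<leftarrow>es. if act e = Piece j then dur e else 0)"

lemma sum_list_dur:
  assumes "\<forall>e\<in>set es. legal_entry I e"
  shows "(\<Sum>e\<leftarrow>es. dur e) =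
    work {..<num_jobs I} es + (\<Sum>i<num_classes I. real (setup_count i es) * stime I i)"
proof -
  have "dur e = (\<Sum>j<num_jobs I. if act e = Piece j then dur e else 0) +
      (\<Sum>i<num_classes I. if act e = Setup i then stime I i else 0)" if "e \<in> set es" for e
  proof -
    have "legal_entry I e" using that assms by simp
    then show ?thesis by (cases e; cases "act e") auto
  qed
  then have "(\<Sum>e\<leftarrow>es. dur e) = (\<Sum>e\<leftarrow>es. (\<Sum>j<num_jobs I. if act e = Piece j then dur e else 0) +
      (\<Sum>i<num_classes I. if act e = Setup i then stime I i else 0))"
    by (intro arg_cong[of _ _ sum_list] map_cong) auto
  also have "\<dots> = work {..<num_jobs I} es +
      (\<Sum>i<num_classes I. \<Sum>e\<leftarrow>es. if act e = Setup i then stime I i else 0)"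
    by (simp add: sum_list_addf sum_list_sum_swap work_def)
  moreover have "(\<Sum>e\<leftarrow>es. if act e = Setup i then stime I i else 0) =
      real (setup_count i es) * stime I i" for i
    unfolding setup_count_def by (induction es) (auto simp: algebra_simps)
  ultimately show ?thesis by simp
qed

lemma work_without_setup:
  assumes "setups_respected I es" "setup_count i es = 0"
  shows "work (jobs_of_class I i) es = 0"
proof -
  have "act e \<noteq> Piece j" if e: "e \<in> set es" and j: "class_of I j = i" for e j
  proof
    assume "act e = Piece j"
    moreover obtain k where "k < length es" "es ! k = e"
      using e by (auto simp: in_set_conv_nth)
    ultimately have "\<exists>d\<in>set es. act d = Setup i"
      using setup_of_piece[OF assms(1), of k j] j by simp
    then obtain d where "d \<in> set es" "act d = Setup i" ..
    from setup_count_pos[OF this] show False using assms(2) by simp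
  qed
  then have "(\<Sum>e\<leftarrow>es. if act e = Piece j then dur e else 0) = 0" if "j \<in> jobs_of_class I i" for j
    using that by (intro sum_list_0_entries) (simp add: jobs_of_class_def)
  then show ?thesis unfolding work_def by (intro sum.neutral ballI)
qed

lemma work_machines:
  assumes "\<forall>e\<in>set \<sigma>. mach e < m"
  shows "(\<Sum>u<m. work K (on_machine \<sigma> u)) = work K \<sigma>"
  unfolding work_def by (subst sum.swap) (simp add: sum_list_machines[OF assms])

lemma setup_count_machines:
  assumes "\<forall>e\<in>set \<sigma>. mach e < m"
  shows "(\<Sum>u<m. setup_count i (on_machine \<sigma> u)) = setup_count i \<sigma>"
  unfolding setup_count_def by (rule sum_list_machines[OF assms])

lemma work_nonneg:
  assumes "\<forall>e\<in>set es. legal_entry I e"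
  shows "0 \<le> work K es"
proof -
  have "0 \<le> dur e" if "e \<in> set es" for e
    using assms that by (cases e; cases "act e") auto
  then show ?thesis unfolding work_def by (auto intro!: sum_nonneg sum_list_nonneg)
qed

text \<open>\<open>B\<close> may exceed the makespan, so that the bounds can be used slightly above
  \<open>T\<close>. For the second one, a machine with \<open>k \<ge> 1\<close> setups has room at
  most \<open>B - k * s \<le> k * (B - s)\<close> for the class, and a machine without such a setup
  processes none of it.\<close>

lemma feasible_setup_counts:
  assumes feas: "pmtn_feasible I \<sigma>" and B: "makespan \<sigma> \<le> B" "0 < B"
  shows "real (load I {..<num_jobs I}) + (\<Sum>i<num_classes I. real (setup_count i \<sigma>) * stime I i)
      \<le> real (num_machines I) * B"
    and "i < num_classes I \<Longrightarrow> class_load I i \<le> real (setup_count i \<sigma>) * (B - stime I i)"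
    and "E \<subseteq> {..<num_classes I} \<Longrightarrow> (\<And>i. i \<in> E \<Longrightarrow> B / 2 < stime I i) \<Longrightarrow>
      (\<Sum>i\<in>E. setup_count i \<sigma>) \<le> num_machines I"
proof -
  let ?m = "num_machines I" and ?n = "num_jobs I" and ?c = "num_classes I"
  let ?on = "on_machine \<sigma>"
  have legal: "\<forall>e\<in>set \<sigma>. legal_entry I e" using feas by (simp add: pmtn_feasible_def)
  have legal_on: "\<forall>e\<in>set (?on u). legal_entry I e" for u
    using legal by (simp add: on_machine_def)
  have start: "0 \<le> start e" "mach e < ?m" if "e \<in> set \<sigma>" for e
  proof -
    have "legal_entry I e" using legal that by simp
    then show "0 \<le> start e" "mach e < ?m" by (cases e; cases "act e"; simp)+
  qed
  have fin: "finish e \<le> B" if "e \<in> set \<sigma>" for e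
  proof -
    have "finish e \<le> makespan \<sigma>" using that by (simp add: makespan_def)
    then show ?thesis using B by simp
  qed
  have machines: "\<forall>e\<in>set \<sigma>. mach e < ?m" using start by simp
  have total: "work {..<?n} (?on u) + (\<Sum>i<?c. real (setup_count i (?on u)) * stime I i) \<le> B"
    if "u < ?m" for u
    unfolding sum_list_dur[OF legal_on, symmetric]
    using sum_list_dur_le[of "?on u" 0 B] feas that start fin B
    by (simp add: pmtn_feasible_def on_machine_def)
  have job: "(\<Sum>e\<leftarrow>\<sigma>. if act e = Piece j then dur e else 0) = real (proc_time I j)" if "j < ?n" for j
    using feas that by (simp add: pmtn_feasible_def sum_list_map_filter')
  have W: "work K \<sigma> = real (load I K)" if "K \<subseteq> {..<?n}" for K
    using that job by (auto simp: work_def load_def intro!: sum.cong)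
  have "work {..<?n} \<sigma> + (\<Sum>i<?c. real (setup_count i \<sigma>) * stime I i) =
      (\<Sum>u<?m. work {..<?n} (?on u) + (\<Sum>i<?c. real (setup_count i (?on u)) * stime I i))"
    unfolding sum_list_dur[OF legal, symmetric] sum_list_dur[OF legal_on, symmetric]
    by (rule sum_list_machines[OF machines, symmetric])
  also have "\<dots> \<le> (\<Sum>u<?m. B)" by (rule sum_mono) (use total in simp)
  finally show "real (load I {..<?n}) + (\<Sum>i<?c. real (setup_count i \<sigma>) * stime I i)
      \<le> real ?m * B"
    by (simp add: W)
  show "class_load I i \<le> real (setup_count i \<sigma>) * (B - stime I i)" if i: "i < ?c"
  proof -
    let ?K = "jobs_of_class I i"
    have K: "?K \<subseteq> {..<?n}" by (auto simp: jobs_of_class_def)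
    have "work ?K (?on u) \<le> real (setup_count i (?on u)) * (B - stime I i)" if u: "u < ?m" for u
    proof (cases "setup_count i (?on u) = 0")
      case True
      have "setups_respected I (?on u)" using feas u by (simp add: pmtn_feasible_def)
      then have "work ?K (?on u) = 0" using True by (rule work_without_setup)
      then show ?thesis using True by simp
    next
      case False
      then have c1: "1 \<le> real (setup_count i (?on u))" by simp
      have "real (setup_count i (?on u)) * stime I i \<le> (\<Sum>i<?c. real (setup_count i (?on u)) * stime I i)"
        using i by (intro member_le_sum) auto
      moreover have "work ?K (?on u) \<le> work {..<?n} (?on u)"
      proof -
        have "work {..<?n} (?on u) = work ?K (?on u) + work ({..<?n} - ?K) (?on u)"
          unfolding work_def using sum.subset_diff[OF K] by (simp add: add.commute)
        then show ?thesis using work_nonneg[OF legal_on] by simp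
      qed
      ultimately have *: "work ?K (?on u) + real (setup_count i (?on u)) * stime I i \<le> B"
        using total[OF u] by linarith
      have "B \<le> real (setup_count i (?on u)) * B" using c1 B by simp
      then show ?thesis using * by (simp add: algebra_simps)
    qed
    then have "(\<Sum>u<?m. work ?K (?on u)) \<le> (\<Sum>u<?m. real (setup_count i (?on u)) * (B - stime I i))"
      by (intro sum_mono) simp
    also have "\<dots> = real (setup_count i \<sigma>) * (B - stime I i)"
      by (simp only: setup_count_machines[OF machines, symmetric] of_nat_sum sum_distrib_right)
    finally show ?thesis
      by (simp only: work_machines[OF machines] W[OF K])
  qed
  show "(\<Sum>i\<in>E. setup_count i \<sigma>) \<le> ?m"
    if E: "E \<subseteq> {..<?c}" and big: "\<And>i. i \<in> E \<Longrightarrow> B / 2 < stime I i"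
  proof -
    have fE: "finite E" using E finite_subset by blast
    have "(\<Sum>i\<in>E. setup_count i (?on u)) \<le> 1" if u: "u < ?m" for u
    \<comment> \<open>Two setups longer than \<open>B / 2\<close> would load the machine beyond
      \<open>B\<close>; strictness comes from a class with a positive count.\<close>
    proof (rule ccontr)
      assume "\<not> ?thesis"
      then have two: "2 \<le> (\<Sum>i\<in>E. setup_count i (?on u))" by simp
      then have "(\<Sum>i\<in>E. setup_count i (?on u)) \<noteq> 0" by simp
      then obtain i where i: "i \<in> E" "0 < setup_count i (?on u)"
        using fE by (auto simp: sum_eq_0_iff)
      have "2 * (B / 2) \<le> real (\<Sum>i\<in>E. setup_count i (?on u)) * (B / 2)"
      proof (rule mult_right_mono)
        have "real 2 \<le> real (\<Sum>i\<in>E. setup_count i (?on u))"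
          using two by (simp only: of_nat_le_iff)
        then show "2 \<le> real (\<Sum>i\<in>E. setup_count i (?on u))" by simp
      qed (use B in simp)
      also have "\<dots> = (\<Sum>i\<in>E. real (setup_count i (?on u)) * (B / 2))"
        by (simp only: of_nat_sum sum_distrib_right)
      also have "\<dots> < (\<Sum>i\<in>E. real (setup_count i (?on u)) * stime I i)"
      proof (rule sum_strict_mono_ex1[OF fE])
        show "\<forall>x\<in>E. real (setup_count x (?on u)) * (B / 2) \<le>
            real (setup_count x (?on u)) * stime I x"
        proof (intro ballI mult_left_mono)
          fix x
          assume "x \<in> E"
          then show "B / 2 \<le> stime I x" using big[of x] by simp
        qed simp
        show "\<exists>x\<in>E. real (setup_count x (?on u)) * (B / 2) <
            real (setup_count x (?on u)) * stime I x"
          using i big[OF i(1)] by (intro bexI[of _ i] mult_strict_left_mono) auto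
      qed
      also have "\<dots> \<le> (\<Sum>i<?c. real (setup_count i (?on u)) * stime I i)"
        using E by (intro sum_mono2) auto
      also have "\<dots> \<le> B"
        using total[OF u] work_nonneg[OF legal_on[of u], of "{..<?n}"] by linarith
      finally show False by simp
    qed
    then have "(\<Sum>u<?m. \<Sum>i\<in>E. setup_count i (?on u)) \<le> (\<Sum>u<?m. 1)"
      by (intro sum_mono) simp
    then show ?thesis
      by (subst (asm) sum.swap) (simp add: setup_count_machines[OF machines])
  qed
qed

section \<open>From single schedules to the optimum\<close>

context bounded_instance
begin

text \<open>The infimum is informative only over a nonempty set. With \<open>T'\<close> at least
  twice every setup time all classes are cheap, so \<open>L_nice\<close> is at most the total load
  and \<open>m_nice\<close> is 0; the algorithm itself then provides a schedule.\<close>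

lemma exists_feasible: "{\<sigma>. pmtn_feasible I \<sigma>} \<noteq> {}"
proof -
  define T' where "T' = max (T_min I) (2 * (\<Sum>i<c. stime I i))"
  interpret big: bounded_instance I T'
    by standard (simp_all add: wf T'_def)
  have "stime I i \<le> (\<Sum>i<c. stime I i)" if "i < c" for i
    using that by (intro member_le_sum) auto
  then have "I_exp I T' = {}"
    by (fastforce simp: I_exp_def T'_def)
  then have E: "I_exp_plus I T' = {}" "I_exp_minus I T' = {}" "I_exp_zero I T' = {}"
    by (auto simp: I_exp_plus_def I_exp_minus_def I_exp_zero_def)
  have "(\<Sum>i\<in>I_chp I T'. setup_time I i) \<le> (\<Sum>i<c. setup_time I i)"
    by (intro sum_mono2) (auto simp: I_chp_def)
  then have "L_nice I T' \<le> total_load I" by (simp add: L_nice_def total_load_def E)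
  then have "real (L_nice I T') \<le> real (total_load I)" by simp
  then interpret big: feasible_bound I T'
    using big.total_load_le by unfold_locales (auto simp: nice_def E m_nice_def)
  show ?thesis using big.pass_cheap_correct by (metis prod_cases3 empty_iff mem_Collect_eq)
qed

text \<open>The classification and \<open>alpha'\<close> refer to \<open>T\<close>, the makespan to
  \<open>B\<close>. The hypotheses say that for \<open>B\<close>, too, \<open>alpha i - 1\<close>
  setups are too few for class \<open>i\<close> and expensive setups exceed half the bound.
  Integrality of the count then yields at least \<open>alpha i\<close> setups.\<close>

lemma makespan_lower_bound:
  assumes feas: "pmtn_feasible I \<sigma>" and B: "makespan \<sigma> \<le> B" "0 < B"
    and alpha: "\<And>i. i < c \<Longrightarrow> (real (alpha i) - 1) * (B - stime I i) < class_load I i"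
    and exp: "\<And>i. i \<in> I_exp I T \<Longrightarrow> B / 2 < stime I i"
  shows "real (L_nice I T) \<le> real m * B" "m_nice I T \<le> m"
proof -
  note counts = feasible_setup_counts[OF feas B]
  have count: "alpha i \<le> setup_count i \<sigma>" "1 \<le> setup_count i \<sigma>" if i: "i < c" for i
  proof -
    have le: "class_load I i \<le> real (setup_count i \<sigma>) * (B - stime I i)" by (rule counts(2)[OF i])
    then have "0 < real (setup_count i \<sigma>) * (B - stime I i)" using class_load_pos[OF i] by linarith
    then have pos: "0 < setup_count i \<sigma>" "0 < B - stime I i"
      by (auto simp: zero_less_mult_iff)
    have "(real (alpha i) - 1) * (B - stime I i) < real (setup_count i \<sigma>) * (B - stime I i)"
      using alpha[OF i] le by linarith
    then have "real (alpha i) - 1 < real (setup_count i \<sigma>)" using pos(2) by simp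
    then show "alpha i \<le> setup_count i \<sigma>" "1 \<le> setup_count i \<sigma>" using pos(1) by linarith+
  qed
  have "(\<Sum>i\<in>exp_plus. alpha i * setup_time I i) + (\<Sum>i\<in>exp_minus \<union> cheap. setup_time I i) \<le>
      (\<Sum>i\<in>exp_plus. setup_count i \<sigma> * setup_time I i) +
      (\<Sum>i\<in>exp_minus \<union> cheap. setup_count i \<sigma> * setup_time I i)"
    using count plus_c minus_c cheap_c by (intro add_mono sum_mono) auto
  also have "\<dots> = (\<Sum>i\<in>exp_plus \<union> (exp_minus \<union> cheap). setup_count i \<sigma> * setup_time I i)"
    using disjoint_kinds by (intro sum.union_disjoint[symmetric]) auto
  also have "\<dots> \<le> (\<Sum>i<c. setup_count i \<sigma> * setup_time I i)"
    using plus_c minus_c cheap_c by (intro sum_mono2) auto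
  finally have "L_nice I T \<le> load I {..<n} + (\<Sum>i<c. setup_count i \<sigma> * setup_time I i)"
    by (simp add: L_nice_def)
  then have "real (L_nice I T) \<le> real (load I {..<n} + (\<Sum>i<c. setup_count i \<sigma> * setup_time I i))"
    using of_nat_le_iff by blast
  then show "real (L_nice I T) \<le> real m * B" using counts(1) by simp
  \<comment> \<open>More is shown than the half in \<open>m_nice\<close> asks for: every class of
    \<open>I_exp_minus\<close> has a setup, and no machine carries two expensive setups.\<close>
  have "m_nice I T \<le> card exp_minus + sum alpha exp_plus"
  proof -
    have "nat \<lceil>real (card exp_minus) / 2\<rceil> \<le> card exp_minus" by linarith
    then show ?thesis by (simp add: m_nice_def)
  qed
  also have "\<dots> \<le> (\<Sum>i\<in>exp_minus. setup_count i \<sigma>) + (\<Sum>i\<in>exp_plus. setup_count i \<sigma>)"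
    unfolding card_eq_sum using count plus_c minus_c by (intro add_mono sum_mono) auto
  also have "\<dots> = (\<Sum>i\<in>exp_minus \<union> exp_plus. setup_count i \<sigma>)"
    using disjoint_kinds by (intro sum.union_disjoint[symmetric]) auto
  also have "\<dots> \<le> m"
    using plus_c minus_c exp by (intro counts(3)) (auto simp: I_exp_plus_def I_exp_minus_def)
  finally show "m_nice I T \<le> m" .
qed

text \<open>An infimum need not be attained, so \<open>T < makespan \<sigma>\<close> for each
  schedule would not suffice; one \<open>B > T\<close> bounding all makespans from below does. It is
  taken from a right neighbourhood of \<open>T\<close>, where the strict conditions persist by
  continuity.\<close>

lemma less_OPT:
  assumes "real m * T < real (L_nice I T) \<or> m < m_nice I T"
  shows "T < OPT_pmtn I"
proof -
  have lim: "((\<lambda>B. (real (alpha i) - 1) * (B - stime I i)) \<longlongrightarrow>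
      (real (alpha i) - 1) * (T - stime I i)) (at_right T)"
    "((\<lambda>B. B / 2) \<longlongrightarrow> T / 2) (at_right T)"
    "((\<lambda>B. real m * B) \<longlongrightarrow> real m * T) (at_right T)" for i
    by (auto intro!: tendsto_intros)
  have "\<forall>\<^sub>F B in at_right T. (real (alpha i) - 1) * (B - stime I i) < class_load I i" if "i < c" for i
  proof (rule order_tendstoD(2)[OF lim(1)])
    \<comment> \<open>At \<open>T\<close> itself,
      \<open>(alpha i - 1) * (T - s) < alpha i * (T - s)\<close>, which is at most the class
      load.\<close>
    show "(real (alpha i) - 1) * (T - stime I i) < class_load I i"
      using alpha_mult_le[OF that] setup_less[OF that] by (simp add: algebra_simps)
  qed
  then have "\<forall>\<^sub>F B in at_right T. \<forall>i\<in>{..<c}. (real (alpha i) - 1) * (B - stime I i) < class_load I i"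
    by (intro eventually_ball_finite) auto
  moreover have "finite (I_exp I T)" by (simp add: I_exp_def)
  then have "\<forall>\<^sub>F B in at_right T. \<forall>i\<in>I_exp I T. B / 2 < stime I i"
    by (intro eventually_ball_finite ballI order_tendstoD(2)[OF lim(2)]) (auto simp: I_exp_def)
  \<comment> \<open>An implication, because the assumption may hold through the machine count
    alone.\<close>
  moreover have "\<forall>\<^sub>F B in at_right T. real m * T < real (L_nice I T) \<longrightarrow> real m * B < real (L_nice I T)"
    using order_tendstoD(2)[OF lim(3), of "real (L_nice I T)"]
    by (cases "real m * T < real (L_nice I T)") auto
  moreover have "\<forall>\<^sub>F B in at_right T. T < B" by (rule eventually_at_right_less)
  ultimately have "\<forall>\<^sub>F B in at_right T. T < B \<and>
      (\<forall>i\<in>{..<c}. (real (alpha i) - 1) * (B - stime I i) < class_load I i) \<and>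
      (\<forall>i\<in>I_exp I T. B / 2 < stime I i) \<and>
      (real m * T < real (L_nice I T) \<longrightarrow> real m * B < real (L_nice I T))"
    by eventually_elim auto
  from eventually_happens'[OF trivial_limit_at_right_real this] obtain B where
    B: "T < B" "\<forall>i\<in>{..<c}. (real (alpha i) - 1) * (B - stime I i) < class_load I i"
      "\<forall>i\<in>I_exp I T. B / 2 < stime I i"
      "real m * T < real (L_nice I T) \<longrightarrow> real m * B < real (L_nice I T)" by blast
  have "B \<le> makespan \<sigma>" if "pmtn_feasible I \<sigma>" for \<sigma>
  proof (rule ccontr)
    assume "\<not> B \<le> makespan \<sigma>"
    then have "real (L_nice I T) \<le> real m * B \<and> m_nice I T \<le> m"
      using makespan_lower_bound[OF that, of B] B T_pos by auto
    then show False using B(4) assms by linarith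
  qed
  then have "B \<le> OPT_pmtn I"
    unfolding OPT_pmtn_def using exists_feasible by (intro cInf_greatest) auto
  then show ?thesis using B(1) by simp
qed

end

theorem theorem4p2:
  "(\<forall>I T. wf_instance I \<and> T_min I \<le> T \<and> nice I T \<longrightarrow>
      real (num_machines I) * T < real (L_nice I T) \<or> num_machines I < m_nice I T \<longrightarrow>
      T < OPT_pmtn I) \<and>
   (\<exists>prog K. \<forall>I T. wf_instance I \<and> T_min I \<le> T \<and> nice I T \<longrightarrow>
      \<not> (real (num_machines I) * T < real (L_nice I T) \<or> num_machines I < m_nice I T) \<longrightarrow>
      (\<exists>steps s. exec prog (input_state I T) steps s \<and>
         steps \<le> K * num_jobs I \<and>
         pmtn_feasible I (output_schedule s) \<and>
         makespan (output_schedule s) \<le> 3 / 2 * T))"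
proof
  show "\<forall>I T. wf_instance I \<and> T_min I \<le> T \<and> nice I T \<longrightarrow>
      real (num_machines I) * T < real (L_nice I T) \<or> num_machines I < m_nice I T \<longrightarrow>
      T < OPT_pmtn I"
    using bounded_instance.less_OPT bounded_instance.intro by blast
  obtain K where K: "\<forall>I T. wf_instance I \<longrightarrow> T_min I \<le> T \<longrightarrow>
     reaches schedule_prog (input_state I T) (K * num_jobs I)
       (good_state I T (pass_cheap I T (num_classes I)))"
    using schedule_prog_reaches ..
  have "\<exists>steps s. exec schedule_prog (input_state I T) steps s \<and> steps \<le> K * num_jobs I \<and>
      pmtn_feasible I (output_schedule s) \<and> makespan (output_schedule s) \<le> 3 / 2 * T"
    if A: "wf_instance I \<and> T_min I \<le> T \<and> nice I T"
      "\<not> (real (num_machines I) * T < real (L_nice I T) \<or> num_machines I < m_nice I T)" for I T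
  proof -
    interpret feasible_bound I T by unfold_locales (use A in auto)
    obtain steps s where s: "exec schedule_prog (input_state I T) steps s" "steps \<le> K * n"
      "good_state I T (pass_cheap I T c) s"
      using K A(1) unfolding reaches_def by blast
    obtain u p \<sigma> where a: "pass_cheap I T c = (u, p, \<sigma>)" by (metis prod_cases3)
    have "output_schedule s = \<sigma>" using s(3) by (simp add: a good_state_def)
    then show ?thesis using s(1,2) pass_cheap_correct[OF a] by blast
  qed
  then show "\<exists>prog K. \<forall>I T. wf_instance I \<and> T_min I \<le> T \<and> nice I T \<longrightarrow>
      \<not> (real (num_machines I) * T < real (L_nice I T) \<or> num_machines I < m_nice I T) \<longrightarrow>
      (\<exists>steps s. exec prog (input_state I T) steps s \<and>
         steps \<le> K * num_jobs I \<and>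
         pmtn_feasible I (output_schedule s) \<and>
         makespan (output_schedule s) \<le> 3 / 2 * T)"
    by blast
qed

end
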